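(* Let $k$ be an infinite field, let $G$ be a finite group whose order is not divisible by the characteristic of $k$, and let $V$ be a representation of $G$ over $k$ of finite dimension $n\ge1$. Then \[\beta(k[V]^G)\leq\rho_G(V)\leq c_G(V)\leq|G|.\]
   Context: $G$ acts on the coordinate ring $k[V]\cong k[x_1,\dots,x_n]$; $k[V]^G$ is the ring of invariants, and $\beta(k[V]^G)$ is the smallest integer $d$ such that $k[V]^G$ is generated as a $k$-algebra by invariants of degree $\le d$. $J\subseteq k[V]$ is the ideal generated by all homogeneous invariants of positive degree, and $\rho_G(V)=\operatorname{reg}(J)$ is its Castelnuovo-Mumford regularity. Here a finitely generated graded module $M$ over a polynomial ring, with minimal graded free resolution $0\to F_l\to\cdots\to F_0\to M\to0$, is $r$-regular if each $F_i$ is generated in degrees $\le r+i$, and $\operatorname{reg}(M)$ is the least integer $r$ such that $M$ is $r$-regular. (Since $k[V]/J$ has finite length, $\rho_G(V)$ is the smallest positive integer $d$ such that every monomial of degree $d$ lies in $J$.) Let $B=\{(v,g\cdot v)\mid v\in V,\ g\in G\}\subset V\times V$ and let $\mathfrak b\subseteq R:=k[V\times V]\cong k[x_1,\dots,x_n,y_1,\dots,y_n]$ be the vanishing ideal of $B$. $c_G(V)$ is the smallest positive integer $d$ such that $\mathfrak b\in\mathcal C_d$, where the classes $\mathcal C_r$ of ideals of $R$ are defined recursively as follows (a linear ideal is an ideal generated by linear forms): $\mathcal C_0=\{(0),R\}$; $\mathcal C_1=\mathcal C_0\cup\{\text{all linear ideals of }R\}$; for $r>1$, $\mathcal C_r$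 is the union of $\{\mathfrak a\cap\mathfrak b'+\mathfrak c\mid\mathfrak a\in\mathcal C_a,\ \mathfrak b'\in\mathcal C_b,\ \mathfrak c\in\mathcal C_1,\ a+b=r,\ a,b\ge1\}$, $\{\mathfrak a\cdot\mathfrak b'+\mathfrak c\mid\mathfrak a\in\mathcal C_a,\ \mathfrak b'\in\mathcal C_b,\ \mathfrak c\in\mathcal C_1,\ a+b=r,\ a,b\ge1\}$, and $\{\mathfrak a+\mathfrak b'\mid\mathfrak a\in\mathcal C_a,\ \mathfrak b'\in\mathcal C_b,\ a+b-1=r,\ a,b\ge2\}$. *)

theory Defs
  imports
    "HOL-Library.Poly_Mapping"
    "HOL-Analysis.Cartesian_Space"
    "HOL-Algebra.Group_Action"
begin

section \<open>Polynomials in finitely many variables\<close>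

text \<open>
  The polynomial ring over \<open>'k\<close> whose variables are the elements of the finite type \<open>'x\<close>;
  a monomial is an exponent vector, and multiplication is the convolution product.
\<close>

type_synonym ('x, 'k) mpoly = "('x \<Rightarrow>\<^sub>0 nat) \<Rightarrow>\<^sub>0 'k"

definition Const :: "'k::field \<Rightarrow> ('x::finite, 'k) mpoly"
  where "Const c = Poly_Mapping.single 0 c"

definition Var :: "'x \<Rightarrow> ('x::finite, 'k::field) mpoly"
  where "Var x = Poly_Mapping.single (Poly_Mapping.single x 1) 1"

definition mdeg :: "('x::finite \<Rightarrow>\<^sub>0 nat) \<Rightarrow> nat"
  where "mdeg m = (\<Sum>x\<in>UNIV. Poly_Mapping.lookup m x)"

text \<open>The zero polynomial is homogeneous of every degree, and nothing else is homogeneous of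
  negative degree.\<close>

definition homogeneous :: "int \<Rightarrow> ('x::finite, 'k::field) mpoly \<Rightarrow> bool"
  where "homogeneous d f \<longleftrightarrow> (\<forall>m\<in>Poly_Mapping.keys f. int (mdeg m) = d)"

definition degree_le :: "nat \<Rightarrow> ('x::finite, 'k::field) mpoly \<Rightarrow> bool"
  where "degree_le d f \<longleftrightarrow> (\<forall>m\<in>Poly_Mapping.keys f. mdeg m \<le> d)"

definition evaluate :: "('k::field \<Rightarrow> 'a::comm_ring_1) \<Rightarrow> ('x::finite \<Rightarrow> 'a) \<Rightarrow> ('x, 'k) mpoly \<Rightarrow> 'a"
  where "evaluate c s f = (\<Sum>m\<in>Poly_Mapping.keys f. c (Poly_Mapping.lookup f m) * (\<Prod>x\<in>UNIV. s x ^ Poly_Mapping.lookup m x))"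

abbreviation eval_at :: "('x::finite \<Rightarrow> 'k::field) \<Rightarrow> ('x, 'k) mpoly \<Rightarrow> 'k"
  where "eval_at \<equiv> evaluate id"

abbreviation substitute ::
    "('x::finite \<Rightarrow> ('z::finite, 'k::field) mpoly) \<Rightarrow> ('x, 'k) mpoly \<Rightarrow> ('z, 'k) mpoly"
  where "substitute \<equiv> evaluate Const"

definition subalgebra :: "('x::finite, 'k::field) mpoly set \<Rightarrow> bool"
  where "subalgebra A \<longleftrightarrow> range Const \<subseteq> A \<and> (\<forall>f\<in>A. \<forall>g\<in>A. f + g \<in> A \<and> f * g \<in> A)"

definition algebra_generated :: "('x::finite, 'k::field) mpoly set \<Rightarrow> ('x, 'k) mpoly set"
  where "algebra_generated S = subalgebra hull S"

definition ideal_generated :: "'a::comm_ring_1 set \<Rightarrow> 'a set"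
  where "ideal_generated S = module.span (*) S"


section \<open>Castelnuovo-Mumford regularity\<close>

text \<open>
  A graded free module of finite rank is given by the list \<open>D\<close> of the degrees of its homogeneous
  basis elements. Its elements are the coordinate vectors supported on the index set of \<open>D\<close>, and a
  homomorphism from the module of \<open>D\<close> to that of \<open>E\<close> is given by a matrix \<open>A\<close>, where \<open>A j\<close> is the
  coordinate vector of the image of the \<open>j\<close>-th basis element.
\<close>

definition free_module :: "int list \<Rightarrow> (nat \<Rightarrow> ('x::finite, 'k::field) mpoly) set"
  where "free_module D = {v. \<forall>j. j \<ge> length D \<longrightarrow> v j = 0}"

definition free_hom ::
    "int list \<Rightarrow> int list \<Rightarrow> (nat \<Rightarrow> nat \<Rightarrow> ('x::finite, 'k::field) mpoly) \<Rightarrow>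
      (nat \<Rightarrow> ('x, 'k) mpoly) \<Rightarrow> nat \<Rightarrow> ('x, 'k) mpoly"
  where "free_hom D E A v = (\<lambda>k. if k < length E then \<Sum>j<length D. v j * A j k else 0)"

text \<open>The map has degree 0.\<close>

definition graded_matrix ::
    "int list \<Rightarrow> int list \<Rightarrow> (nat \<Rightarrow> nat \<Rightarrow> ('x::finite, 'k::field) mpoly) \<Rightarrow> bool"
  where "graded_matrix D E A \<longleftrightarrow>
    (\<forall>j<length D. \<forall>k<length E. homogeneous (D ! j - E ! k) (A j k))"

text \<open>The image of the map is contained in \<open>\<mm> E\<close>, where \<open>\<mm>\<close> is the ideal generated by the
  variables.\<close>

definition minimal_matrix ::
    "int list \<Rightarrow> int list \<Rightarrow> (nat \<Rightarrow> nat \<Rightarrow> ('x::finite, 'k::field) mpoly) \<Rightarrow> bool"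
  where "minimal_matrix D E A \<longleftrightarrow>
    (\<forall>j<length D. \<forall>k<length E. A j k \<in> ideal_generated (range Var))"

definition augmentation ::
    "int list \<Rightarrow> (nat \<Rightarrow> ('x::finite, 'k::field) mpoly) \<Rightarrow> (nat \<Rightarrow> ('x, 'k) mpoly) \<Rightarrow> ('x, 'k) mpoly"
  where "augmentation D e v = (\<Sum>j<length D. v j * e j)"

text \<open>
  Minimal graded free resolutions \<open>0 \<rightarrow> F l \<rightarrow> \<dots> \<rightarrow> F 0 \<rightarrow> I \<rightarrow> 0\<close> of an ideal \<open>I\<close>. The matrix \<open>A i\<close>
  represents the map from \<open>F (i + 1)\<close> to \<open>F i\<close>, and \<open>e\<close> the map from \<open>F 0\<close> onto \<open>I\<close>. Injectivity on
  \<open>F l\<close> is the exactness condition for \<open>i = l\<close>, since \<open>F (l + 1) = 0\<close>.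
\<close>

definition minimal_free_resolution ::
    "('x::finite, 'k::field) mpoly set \<Rightarrow> (nat \<Rightarrow> int list) \<Rightarrow> (nat \<Rightarrow> ('x, 'k) mpoly) \<Rightarrow>
      (nat \<Rightarrow> nat \<Rightarrow> nat \<Rightarrow> ('x, 'k) mpoly) \<Rightarrow> bool"
  where "minimal_free_resolution I F e A \<longleftrightarrow>
    (\<exists>l. \<forall>i>l. F i = []) \<and>
    (\<forall>j<length (F 0). homogeneous (F 0 ! j) (e j)) \<and>
    (\<forall>i. graded_matrix (F (Suc i)) (F i) (A i) \<and> minimal_matrix (F (Suc i)) (F i) (A i)) \<and>
    augmentation (F 0) e ` free_module (F 0) = I \<and>
    free_hom (F 1) (F 0) (A 0) ` free_module (F 1) =
      {v \<in> free_module (F 0). augmentation (F 0) e v = 0} \<and>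
    (\<forall>i. free_hom (F (Suc (Suc i))) (F (Suc i)) (A (Suc i)) ` free_module (F (Suc (Suc i))) =
      {v \<in> free_module (F (Suc i)). free_hom (F (Suc i)) (F i) (A i) v = (\<lambda>_. 0)})"

text \<open>The minimal resolution is unique up to isomorphism, so the degrees below do not depend on
  the choice.\<close>

definition regular_ideal :: "int \<Rightarrow> ('x::finite, 'k::field) mpoly set \<Rightarrow> bool"
  where "regular_ideal r I \<longleftrightarrow>
    (\<exists>F e A. minimal_free_resolution I F e A \<and> (\<forall>i. \<forall>d\<in>set (F i). d \<le> r + int i))"

definition reg :: "('x::finite, 'k::field) mpoly set \<Rightarrow> int"
  where "reg I = (LEAST r. regular_ideal r I)"


section \<open>Representations and invariants\<close>

definition representation :: "('g, 'b) monoid_scheme \<Rightarrow> ('g \<Rightarrow> 'k::field ^ 'n::finite \<Rightarrow> 'k ^ 'n) \<Rightarrow> bool"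
  where "representation G \<phi> \<longleftrightarrow>
    group_action G UNIV \<phi> \<and> (\<forall>g\<in>carrier G. Vector_Spaces.linear (*s) (*s) (\<phi> g))"

text \<open>The polynomial \<open>g \<cdot> f\<close> is the function mapping \<open>v\<close> to \<open>f (g\<inverse> \<cdot> v)\<close>.\<close>

definition act :: "('g, 'b) monoid_scheme \<Rightarrow> ('g \<Rightarrow> 'k::field ^ 'n::finite \<Rightarrow> 'k ^ 'n) \<Rightarrow> 'g \<Rightarrow>
    ('n, 'k) mpoly \<Rightarrow> ('n, 'k) mpoly"
  where "act G \<phi> g =
    substitute (\<lambda>i. \<Sum>j\<in>UNIV. Const (matrix (\<phi> (inv\<^bsub>G\<^esub> g)) $ i $ j) * Var j)"

definition invariant_ring ::
    "('g, 'b) monoid_scheme \<Rightarrow> ('g \<Rightarrow> 'k::field ^ 'n::finite \<Rightarrow> 'k ^ 'n) \<Rightarrow> ('n, 'k) mpoly set"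
  where "invariant_ring G \<phi> = {f. \<forall>g\<in>carrier G. act G \<phi> g f = f}"

definition beta :: "('g, 'b) monoid_scheme \<Rightarrow> ('g \<Rightarrow> 'k::field ^ 'n::finite \<Rightarrow> 'k ^ 'n) \<Rightarrow> nat"
  where "beta G \<phi> =
    (LEAST d. algebra_generated {f \<in> invariant_ring G \<phi>. degree_le d f} = invariant_ring G \<phi>)"

definition hilbert_ideal ::
    "('g, 'b) monoid_scheme \<Rightarrow> ('g \<Rightarrow> 'k::field ^ 'n::finite \<Rightarrow> 'k ^ 'n) \<Rightarrow> ('n, 'k) mpoly set"
  where "hilbert_ideal G \<phi> = ideal_generated {f \<in> invariant_ring G \<phi>. \<exists>d>0. homogeneous d f}"

definition rho :: "('g, 'b) monoid_scheme \<Rightarrow> ('g \<Rightarrow> 'k::field ^ 'n::finite \<Rightarrow> 'k ^ 'n) \<Rightarrow> int"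
  where "rho G \<phi> = reg (hilbert_ideal G \<phi>)"


section \<open>The ideal of the graph of the action\<close>

definition linear_ideal :: "('x::finite, 'k::field) mpoly set \<Rightarrow> bool"
  where "linear_ideal I \<longleftrightarrow> (\<exists>L. (\<forall>f\<in>L. homogeneous 1 f) \<and> I = ideal_generated L)"

definition ideal_sum :: "'a::comm_ring_1 set \<Rightarrow> 'a set \<Rightarrow> 'a set"
  where "ideal_sum I J = {f + g |f g. f \<in> I \<and> g \<in> J}"

definition ideal_prod :: "'a::comm_ring_1 set \<Rightarrow> 'a set \<Rightarrow> 'a set"
  where "ideal_prod I J = ideal_generated {f * g |f g. f \<in> I \<and> g \<in> J}"

text \<open>\<open>in_class r I\<close> says that \<open>I\<close> belongs to the class \<open>\<C>\<^sub>r\<close>.\<close>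

inductive in_class :: "nat \<Rightarrow> ('x::finite, 'k::field) mpoly set \<Rightarrow> bool"
  where
    zero_0: "in_class 0 {0}"
  | unit_0: "in_class 0 UNIV"
  | class_0_1: "in_class 0 I \<Longrightarrow> in_class 1 I"
  | linear_1: "linear_ideal I \<Longrightarrow> in_class 1 I"
  | inter: "\<lbrakk>in_class a I; in_class b J; in_class 1 K; a + b = r; a \<ge> 1; b \<ge> 1\<rbrakk>
      \<Longrightarrow> in_class r (ideal_sum (I \<inter> J) K)"
  | prod: "\<lbrakk>in_class a I; in_class b J; in_class 1 K; a + b = r; a \<ge> 1; b \<ge> 1\<rbrakk>
      \<Longrightarrow> in_class r (ideal_sum (ideal_prod I J) K)"
  | sum: "\<lbrakk>in_class a I; in_class b J; a + b - 1 = r; a \<ge> 2; b \<ge> 2\<rbrakk>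
      \<Longrightarrow> in_class r (ideal_sum I J)"

text \<open>Coordinates on \<open>V \<times> V\<close>: \<open>Inl i\<close> is the variable \<open>x\<^sub>i\<close> and \<open>Inr i\<close> the variable \<open>y\<^sub>i\<close>.\<close>

definition graph_points ::
    "('g, 'b) monoid_scheme \<Rightarrow> ('g \<Rightarrow> 'k::field ^ 'n::finite \<Rightarrow> 'k ^ 'n) \<Rightarrow> (('k ^ 'n) \<times> ('k ^ 'n)) set"
  where "graph_points G \<phi> = {(v, \<phi> g v) |v g. g \<in> carrier G}"

definition vanishing_ideal :: "(('k::field ^ 'n::finite) \<times> ('k ^ 'n)) set \<Rightarrow> ('n + 'n, 'k) mpoly set"
  where "vanishing_ideal B = {f. \<forall>(v, w)\<in>B. eval_at (case_sum (($) v) (($) w)) f = 0}"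

definition c_number :: "('g, 'b) monoid_scheme \<Rightarrow> ('g \<Rightarrow> 'k::field ^ 'n::finite \<Rightarrow> 'k ^ 'n) \<Rightarrow> nat"
  where "c_number G \<phi> = (LEAST d. d > 0 \<and> in_class d (vanishing_ideal (graph_points G \<phi>)))"

end

theory Submission
  imports Defs "HOL-Computational_Algebra.Polynomial" "HOL-Library.Function_Algebras"
begin

text \<open>
  Write \<open>S = k[V]\<close> and \<open>\<mm>\<close> for the ideal generated by the variables, \<open>J\<close> for the ideal generated by
  the homogeneous invariants of positive degree, \<open>\<bb>\<close> for the vanishing ideal of the union of the
  graphs of the group elements, and \<open>(y)\<close> for the ideal of the second set of coordinates.

  \<^emph>\<open>The bound \<open>\<beta> \<le> \<rho>\<close>.\<close> The degrees in the first step of a resolution bound the degrees of generators of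
  \<open>J\<close>, so \<open>J\<close> is generated by invariants of degree at most \<open>\<rho>\<close>
  (\<open>hilbert_ideal_generated_low_degree\<close>). A homogeneous invariant of larger degree is an \<open>S\<close>-linear
  combination of these; averaging the coefficients over the group makes them invariants of smaller
  degree, and Hilbert's induction on the degree applies (\<open>beta_le_if_regular\<close>).

  \<^emph>\<open>The bound \<open>\<rho> \<le> c\<close>.\<close> Three facts are combined.

  First, if a homogeneous ideal contains \<open>\<mm>^d\<close>, then it is \<open>d\<close>-regular
  (\<open>regular_ideal_if_contains_degree\<close>). The minimal resolution is built one syzygy module at a time.
  Exactness of the Koszul complex of a free module shows that the \<open>p\<close>-th Koszul homology of a syzygy
  module embeds in the \<open>(p + 1)\<close>-st of the module it resolves (\<open>koszul_acyclic_syzygies\<close>). Hence the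
  minimal generators of the \<open>i\<close>-th syzygy module are controlled by the \<open>i\<close>-th Koszul homology of the
  ideal, which vanishes above internal degree \<open>d\<close> and for \<open>i > n\<close>. This gives both the degree bound
  and the finite length.

  Second, for \<open>r \<ge> 1\<close> an ideal of class \<open>\<C>\<^sub>r\<close> contains \<open>\<mm>^r\<close> as soon as it contains some power of \<open>\<mm>\<close>, also after
  a linear ideal is added to it (\<open>in_class_contains_degree\<close>). Replacing every intersection by a product
  in the construction of the ideal keeps its radical and makes it smaller, so it suffices to treat
  ideals built by sums and products alone. These are generated in degree at most \<open>r\<close>, and that makes
  an induction over the construction work (\<open>approximately_regular_prod\<close>).

  Third, setting \<open>y = 0\<close> maps \<open>\<bb> + (y)\<close> into \<open>J\<close>: for \<open>f(x, y)\<close> in \<open>\<bb>\<close> all the polynomials \<open>f(x, g x)\<close> are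
  zero, and their average agrees with \<open>f(x, 0)\<close> modulo \<open>J\<close> (\<open>average_graph_subst\<close>). Moreover
  \<open>\<bb> + (y)\<close> contains a power of every variable, because the product over \<open>g\<close> of the differences of \<open>x\<^sub>i\<close>
  and the \<open>i\<close>-th coordinate of \<open>g y\<close> lies in \<open>\<bb>\<close>. The second fact then puts \<open>\<mm>^c\<close> into \<open>J\<close>
  (\<open>contains_degree_hilbert_ideal\<close>), and the first one finishes.

  \<^emph>\<open>The bound \<open>c \<le> |G|\<close>.\<close> Over an infinite field, \<open>\<bb>\<close> is the intersection of the linear ideals of the
  \<open>|G|\<close> graphs (\<open>in_class_graph\<close>).
\<close>

hide_const (open) Polynomial.order

section \<open>Polynomials\<close>

lemma poly_mapping_sum_singles:
  "(\<Sum>m\<in>Poly_Mapping.keys f. Poly_Mapping.single m (Poly_Mapping.lookup f m)) = f"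
  by (rule poly_mapping_eqI)
    (auto simp: lookup_sum lookup_single when_def in_keys_iff sum.delta)

lemma poly_mapping_single_induct [case_names zero single add]:
  fixes f :: "'a \<Rightarrow>\<^sub>0 'b::comm_monoid_add"
  assumes "P 0" and "\<And>m c. P (Poly_Mapping.single m c)" and "\<And>f g. P f \<Longrightarrow> P g \<Longrightarrow> P (f + g)"
  shows "P f"
proof -
  have "P (\<Sum>m\<in>A. Poly_Mapping.single m (Poly_Mapping.lookup f m))" if "finite A" for A
    using that by (induction A) (auto intro: assms)
  from this[of "Poly_Mapping.keys f"] show ?thesis
    by (simp add: poly_mapping_sum_singles)
qed

lemma lookup_single_mult:
  fixes f :: "('x \<Rightarrow>\<^sub>0 nat) \<Rightarrow>\<^sub>0 'k::comm_ring_1"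
  shows "Poly_Mapping.lookup (Poly_Mapping.single m c * f) (m + k) = c * Poly_Mapping.lookup f k"
proof (induction f rule: poly_mapping_single_induct)
  case (single m' c')
  then show ?case by (auto simp: mult_single lookup_single when_def)
qed (auto simp: lookup_add algebra_simps)

lemma lookup_single_mult_zero:
  fixes f :: "('x \<Rightarrow>\<^sub>0 nat) \<Rightarrow>\<^sub>0 'k::comm_ring_1"
  assumes "\<And>k. n \<noteq> m + k"
  shows "Poly_Mapping.lookup (Poly_Mapping.single m c * f) n = 0"
proof (induction f rule: poly_mapping_single_induct)
  case (single m' c')
  then show ?case using assms by (auto simp: mult_single lookup_single when_def)
qed (auto simp: lookup_add algebra_simps)

lemma monomial_minus_add:
  fixes m :: "'x \<Rightarrow>\<^sub>0 nat"
  assumes "Poly_Mapping.lookup m x > 0"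
  shows "Poly_Mapping.single x 1 + (m - Poly_Mapping.single x 1) = m"
  using assms by (intro poly_mapping_eqI) (auto simp: lookup_add lookup_minus lookup_single when_def)

lemma lookup_Var_mult:
  "Poly_Mapping.lookup (Var x * f) m =
    (if Poly_Mapping.lookup m x > 0 then Poly_Mapping.lookup f (m - Poly_Mapping.single x 1) else 0)"
proof (cases "Poly_Mapping.lookup m x > 0")
  case True
  then show ?thesis
    using lookup_single_mult[of "Poly_Mapping.single x 1" 1 f "m - Poly_Mapping.single x 1"]
    unfolding monomial_minus_add[OF True] by (simp add: Var_def)
next
  case False
  then have "m \<noteq> Poly_Mapping.single x 1 + k" for k
    by (auto simp: lookup_add lookup_single)
  with False show ?thesis by (simp add: Var_def lookup_single_mult_zero)
qed

lemma Const_0 [simp]: "Const 0 = 0" and Const_1 [simp]: "Const 1 = 1"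
  and Const_add: "Const (a + b) = Const a + Const b"
  and Const_mult: "Const (a * b) = Const a * Const b"
  by (simp_all add: Const_def single_add mult_single)

lemma Const_minus: "Const (- a) = - Const a"
  by (simp add: Const_def single_uminus)

lemma Const_of_nat: "Const (of_nat n) = of_nat n"
  by (simp add: Const_def)

lemma lookup_Const_mult [simp]: "Poly_Mapping.lookup (Const c * f) m = c * Poly_Mapping.lookup f m"
  using lookup_single_mult[of 0 c f m] by (simp add: Const_def)

subsection \<open>Homogeneous components\<close>

lemma mdeg_0 [simp]: "mdeg 0 = 0" and mdeg_add: "mdeg (m + m') = mdeg m + mdeg m'"
  by (simp_all add: mdeg_def lookup_add sum.distrib)

lemma mdeg_single [simp]: "mdeg (Poly_Mapping.single x e) = e"
  by (simp add: mdeg_def lookup_single when_def)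

lemma mdeg_eq_0_iff [simp]: "mdeg m = 0 \<longleftrightarrow> m = 0"
  by (auto simp: mdeg_def poly_mapping_eq_iff fun_eq_iff)

lemma homogeneous_lookup:
  "homogeneous d f \<longleftrightarrow> (\<forall>m. Poly_Mapping.lookup f m \<noteq> 0 \<longrightarrow> int (mdeg m) = d)"
  by (auto simp: homogeneous_def in_keys_iff)

lemma homogeneous_0 [simp]: "homogeneous d 0"
  by (simp add: homogeneous_def)

lemma homogeneous_Const [simp]: "homogeneous 0 (Const c)"
  by (simp add: homogeneous_def Const_def)

lemma homogeneous_1 [simp]: "homogeneous 0 1"
  by (simp add: homogeneous_def)

lemma homogeneous_Var [simp]: "homogeneous 1 (Var x)"
  by (simp add: homogeneous_def Var_def)

lemma homogeneous_add: "homogeneous d f \<Longrightarrow> homogeneous d g \<Longrightarrow> homogeneous d (f + g)"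
  using keys_add[of f g] by (auto simp: homogeneous_def)

lemma homogeneous_uminus: "homogeneous d f \<Longrightarrow> homogeneous d (- f)"
  by (auto simp: homogeneous_lookup)

lemma homogeneous_diff: "homogeneous d f \<Longrightarrow> homogeneous d g \<Longrightarrow> homogeneous d (f - g)"
  using homogeneous_add[of d f "- g"] by (simp add: homogeneous_uminus)

lemma homogeneous_sum: "(\<And>x. x \<in> A \<Longrightarrow> homogeneous d (f x)) \<Longrightarrow> homogeneous d (sum f A)"
  by (induction A rule: infinite_finite_induct) (auto intro: homogeneous_add)

lemma homogeneous_mult: "homogeneous d f \<Longrightarrow> homogeneous e g \<Longrightarrow> homogeneous (d + e) (f * g)"
  using keys_mult[of f g] by (force simp: homogeneous_def mdeg_add)

lemma homogeneous_Const_mult: "homogeneous d f \<Longrightarrow> homogeneous d (Const c * f)"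
  using homogeneous_mult[OF homogeneous_Const] by fastforce

lemma homogeneous_power: "homogeneous d f \<Longrightarrow> homogeneous (int n * d) (f ^ n)"
proof (induction n)
  case (Suc n)
  then show ?case using homogeneous_mult[of d f "int n * d" "f ^ n"] by (simp add: algebra_simps)
qed auto

lemma homogeneous_prod:
  "(\<And>x. x \<in> A \<Longrightarrow> homogeneous (d x) (f x)) \<Longrightarrow> homogeneous (sum d A) (prod f A)"
  by (induction A rule: infinite_finite_induct) (auto intro: homogeneous_mult)

lemma homogeneous_neg: "homogeneous d f \<Longrightarrow> d < 0 \<Longrightarrow> f = 0"
  by (rule poly_mapping_eqI) (fastforce simp: homogeneous_lookup)

lemma homogeneous_single: "homogeneous (int (mdeg m)) (Poly_Mapping.single m c)"
  by (simp add: homogeneous_def)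

definition hcomp :: "int \<Rightarrow> ('x::finite, 'k::field) mpoly \<Rightarrow> ('x, 'k) mpoly"
  where "hcomp d f = Poly_Mapping.mapp (\<lambda>m c. if int (mdeg m) = d then c else 0) f"

lemma lookup_hcomp:
  "Poly_Mapping.lookup (hcomp d f) m = (if int (mdeg m) = d then Poly_Mapping.lookup f m else 0)"
  by (auto simp: hcomp_def lookup_mapp when_def in_keys_iff)

lemma hcomp_0 [simp]: "hcomp d 0 = 0"
  by (rule poly_mapping_eqI) (simp add: lookup_hcomp)

lemma hcomp_add: "hcomp d (f + g) = hcomp d f + hcomp d g"
  by (rule poly_mapping_eqI) (simp add: lookup_hcomp lookup_add)

lemma hcomp_sum: "hcomp d (sum f A) = (\<Sum>x\<in>A. hcomp d (f x))"
  by (induction A rule: infinite_finite_induct) (auto simp: hcomp_add)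

lemma homogeneous_hcomp [simp]: "homogeneous d (hcomp d f)"
  by (auto simp: homogeneous_lookup lookup_hcomp)

lemma hcomp_homogeneous: "homogeneous d f \<Longrightarrow> hcomp e f = (if e = d then f else 0)"
  by (rule poly_mapping_eqI) (auto simp: lookup_hcomp homogeneous_lookup)

lemma hcomp_mult:
  assumes "homogeneous s g"
  shows "hcomp t (f * g) = hcomp (t - s) f * g"
proof (induction f rule: poly_mapping_single_induct)
  case (single m c)
  show ?case
    using hcomp_homogeneous[OF homogeneous_mult[OF homogeneous_single[of m c] assms], of t]
      hcomp_homogeneous[OF homogeneous_single[of m c], of "t - s"] by (auto simp: algebra_simps)
qed (auto simp: hcomp_add algebra_simps)

lemma sum_hcomp:
  assumes "finite T" and "\<And>m. m \<in> Poly_Mapping.keys f \<Longrightarrow> int (mdeg m) \<in> T"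
  shows "(\<Sum>t\<in>T. hcomp t f) = f"
  using assms by (intro poly_mapping_eqI) (auto simp: lookup_sum lookup_hcomp sum.delta in_keys_iff)

lemma homogeneous_0_eq_Const: "homogeneous 0 f \<Longrightarrow> f = Const (Poly_Mapping.lookup f 0)"
  by (rule poly_mapping_eqI) (auto simp: homogeneous_lookup Const_def lookup_single when_def)

lemma single_eq_Const_mult:
  "Poly_Mapping.single m c = Const c * Poly_Mapping.single m 1"
  by (simp add: Const_def mult_single)

lemma power_Var: "Var x ^ n = Poly_Mapping.single (Poly_Mapping.single x n) 1"
  by (induction n) (simp_all add: Var_def mult_single single_add[symmetric] one_poly_mapping_def)

lemma sum_single_prod: "finite A \<Longrightarrow>
  (\<Prod>x\<in>A. Poly_Mapping.single (g x) (1::'k::field)) = Poly_Mapping.single (sum g A) (1::'k)"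
  by (induction A rule: finite_induct) (auto simp: mult_single)

lemma monomial_eq_prod:
  "Poly_Mapping.single m 1 = (\<Prod>x\<in>UNIV. Var x ^ Poly_Mapping.lookup m x)"
proof -
  have "(\<Sum>x\<in>UNIV. Poly_Mapping.single x (Poly_Mapping.lookup m x)) = m"
    by (rule poly_mapping_eqI) (simp add: lookup_sum lookup_single when_def sum.delta)
  then show ?thesis by (simp add: power_Var sum_single_prod)
qed

subsection \<open>Evaluation\<close>

text \<open>
  Covers both the evaluation at points and the substitution of polynomials.
\<close>

locale coefficient_hom =
  fixes c :: "'k::field \<Rightarrow> 'a::comm_ring_1"
  assumes c_0: "c 0 = 0" and c_1: "c 1 = 1"
    and c_add: "c (a + b) = c a + c b" and c_mult: "c (a * b) = c a * c b"
begin

lemma evaluate_single: "evaluate c s (Poly_Mapping.single m a) = c a * (\<Prod>x\<in>UNIV. s x ^ Poly_Mapping.lookup m x)"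
  by (simp add: evaluate_def c_0)

lemma evaluate_0: "evaluate c s 0 = 0"
  by (simp add: evaluate_def)

lemma evaluate_add: "evaluate c s (f + g) = evaluate c s f + evaluate c s g"
  unfolding evaluate_def
  by (rule setsum_keys_plus_distrib) (simp_all add: c_0 c_add algebra_simps)

lemma evaluate_mult: "evaluate c s (f * g) = evaluate c s f * evaluate c s g"
proof (induction f rule: poly_mapping_single_induct)
  case (single m a)
  show ?case
    by (induction g rule: poly_mapping_single_induct)
      (auto simp: evaluate_single evaluate_add evaluate_0 mult_single c_mult lookup_add power_add
        prod.distrib algebra_simps)
qed (auto simp: evaluate_add evaluate_0 algebra_simps)

lemma evaluate_Const: "evaluate c s (Const a) = c a"
  by (simp add: Const_def evaluate_single)

lemma evaluate_Var: "evaluate c s (Var x) = s x"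
proof -
  have "(\<Prod>y\<in>UNIV. s y ^ Poly_Mapping.lookup (Poly_Mapping.single x 1) y) = (\<Prod>y\<in>UNIV. if y = x then s y else 1)"
    by (rule prod.cong) (auto simp: lookup_single when_def)
  then show ?thesis by (simp add: Var_def evaluate_single c_1)
qed

lemma evaluate_1: "evaluate c s 1 = 1"
  using evaluate_Const[of s 1] by (simp add: c_1)

lemma evaluate_uminus: "evaluate c s (- f) = - evaluate c s f"
  using evaluate_add[of s f "- f"] by (simp add: evaluate_0 add_eq_0_iff)

lemma evaluate_diff: "evaluate c s (f - g) = evaluate c s f - evaluate c s g"
  using evaluate_add[of s f "- g"] by (simp add: evaluate_uminus)

lemma evaluate_power: "evaluate c s (f ^ n) = evaluate c s f ^ n"
  by (induction n) (auto simp: evaluate_1 evaluate_mult)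

lemma evaluate_sum: "evaluate c s (sum f A) = (\<Sum>x\<in>A. evaluate c s (f x))"
  by (induction A rule: infinite_finite_induct) (auto simp: evaluate_0 evaluate_add)

lemma evaluate_prod: "evaluate c s (prod f A) = (\<Prod>x\<in>A. evaluate c s (f x))"
  by (induction A rule: infinite_finite_induct) (auto simp: evaluate_1 evaluate_mult)

lemmas evaluate_simps = evaluate_0 evaluate_1 evaluate_add evaluate_mult evaluate_Const evaluate_Var
  evaluate_uminus evaluate_diff evaluate_power evaluate_sum evaluate_prod

end

interpretation eval_at: coefficient_hom "id :: 'k::field \<Rightarrow> 'k"
  by unfold_locales auto

lemmas eval_at_simps = eval_at.evaluate_simps[unfolded id_def]

interpretation substitute: coefficient_hom "Const :: 'k::field \<Rightarrow> ('x::finite, 'k) mpoly"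
  by unfold_locales (auto simp: Const_add Const_mult)

lemma mpoly_induct [case_names Const Var add mult]:
  fixes f :: "('x::finite, 'k::field) mpoly"
  assumes C: "\<And>c. P (Const c)" and V: "\<And>x. P (Var x)"
    and A: "\<And>f g. P f \<Longrightarrow> P g \<Longrightarrow> P (f + g)" and M: "\<And>f g. P f \<Longrightarrow> P g \<Longrightarrow> P (f * g)"
  shows "P f"
proof (induction f rule: poly_mapping_single_induct)
  case (single m c)
  have pw: "P (Var x ^ n)" for x n
    by (induction n) (use C[of 1] in \<open>auto intro: V M\<close>)
  have "P (\<Prod>x\<in>A. Var x ^ Poly_Mapping.lookup m x)" for A
    by (induction A rule: infinite_finite_induct) (use C[of 1] in \<open>auto intro: pw M\<close>)
  then show ?case
    unfolding single_eq_Const_mult[of m c] monomial_eq_prod by (intro M C)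
qed (use C[of 0] A in auto)

lemma eval_at_substitute:
  "eval_at v (substitute \<sigma> f) = eval_at (\<lambda>x. eval_at v (\<sigma> x)) f"
  by (induction f rule: mpoly_induct)
    (simp_all add: id_def eval_at_simps substitute.evaluate_simps)

lemma substitute_substitute:
  "substitute \<tau> (substitute \<sigma> f) = substitute (\<lambda>x. substitute \<tau> (\<sigma> x)) f"
  by (induction f rule: mpoly_induct) (simp_all add: substitute.evaluate_simps)

lemma substitute_Var: "substitute Var f = f"
  by (induction f rule: mpoly_induct) (simp_all add: substitute.evaluate_simps)

lemma homogeneous_substitute:
  assumes "homogeneous d f" and "\<And>x. homogeneous 1 (\<sigma> x)"
  shows "homogeneous d (substitute \<sigma> f)"
  unfolding evaluate_def
proof (rule homogeneous_sum)
  fix m assume "m \<in> Poly_Mapping.keys f"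
  with assms(1) have d: "d = (\<Sum>x\<in>UNIV. int (Poly_Mapping.lookup m x) * 1)"
    by (auto simp: homogeneous_def mdeg_def)
  show "homogeneous d (Const (Poly_Mapping.lookup f m) * (\<Prod>x\<in>UNIV. \<sigma> x ^ Poly_Mapping.lookup m x))"
    unfolding d by (intro homogeneous_Const_mult homogeneous_prod homogeneous_power assms)
qed

subsection \<open>Ideals\<close>

lemma module_mult: "module ((*) :: 'a::comm_ring_1 \<Rightarrow> 'a \<Rightarrow> 'a)"
  by unfold_locales (auto simp: algebra_simps)

abbreviation ideal :: "'a::comm_ring_1 set \<Rightarrow> bool"
  where "ideal \<equiv> module.subspace (*)"

lemma ideal_ideal_generated [simp]: "ideal (ideal_generated S)"
  by (simp add: ideal_generated_def module.subspace_span[OF module_mult])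

lemma ideal_generated_superset: "s \<in> S \<Longrightarrow> s \<in> ideal_generated S"
  by (simp add: ideal_generated_def module.span_base[OF module_mult])

lemma ideal_generated_minimal: "S \<subseteq> I \<Longrightarrow> ideal I \<Longrightarrow> ideal_generated S \<subseteq> I"
  by (simp add: ideal_generated_def module.span_minimal[OF module_mult])

lemma ideal_generated_induct [consumes 1, case_names zero add]:
  assumes "f \<in> ideal_generated S" and "P 0" and "\<And>a s g. s \<in> S \<Longrightarrow> P g \<Longrightarrow> P (a * s + g)"
  shows "P f"
  using assms unfolding ideal_generated_def by (rule module.span_induct_alt[OF module_mult])

lemmas ideal_0 = module.subspace_0[OF module_mult]
lemmas ideal_add = module.subspace_add[OF module_mult]
lemmas ideal_mult = module.subspace_scale[OF module_mult]
lemmas ideal_sum_mem = module.subspace_sum[OF module_mult]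

lemma ideal_mult_right: "ideal I \<Longrightarrow> f \<in> I \<Longrightarrow> f * g \<in> I"
  using ideal_mult[of I f g] by (simp add: mult.commute)

lemma ideal_sum_eq_generated:
  "ideal_sum (ideal_generated S) (ideal_generated T) = ideal_generated (S \<union> T)"
  unfolding ideal_sum_def ideal_generated_def module.span_Un[OF module_mult] by auto

lemma ideal_ideal_sum: "ideal I \<Longrightarrow> ideal J \<Longrightarrow> ideal (ideal_sum I J)"
  using ideal_sum_eq_generated[of I J]
  by (metis ideal_generated_def ideal_ideal_generated module.span_eq_iff[OF module_mult])

lemma ideal_sum_0 [simp]: "ideal_sum I {0} = I"
  by (auto simp: ideal_sum_def)

lemma ideal_sumI: "f \<in> I \<Longrightarrow> g \<in> J \<Longrightarrow> f + g \<in> ideal_sum I J"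
  by (auto simp: ideal_sum_def)

lemma ideal_sumI1: "f \<in> I \<Longrightarrow> ideal J \<Longrightarrow> f \<in> ideal_sum I J"
  using ideal_sumI[of f I 0 J] ideal_0[of J] by simp

lemma ideal_sumI2: "ideal I \<Longrightarrow> f \<in> J \<Longrightarrow> f \<in> ideal_sum I J"
  using ideal_sumI[of 0 I f J] ideal_0[of I] by simp

subsection \<open>Infinite fields\<close>

text \<open>
  Exponent vectors are functions here, and only their restrictions to \<open>X\<close> have to be distinct: the
  terms sharing one exponent of the new variable \<open>x\<close> still differ on the old variables, so by induction
  some values of these make their sum nonzero. That sum is a coefficient of a polynomial in \<open>x\<close>, which
  has only finitely many roots.
\<close>

lemma nonvanishing_point:
  fixes a :: "('x \<Rightarrow> nat) \<Rightarrow> 'k::field"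
  assumes inf: "infinite (UNIV :: 'k set)" and "finite X"
  shows "finite K \<Longrightarrow> K \<noteq> {} \<Longrightarrow> (\<forall>m\<in>K. a m \<noteq> 0) \<Longrightarrow> inj_on (\<lambda>m. restrict m X) K \<Longrightarrow>
    \<exists>v. (\<Sum>m\<in>K. a m * (\<Prod>x\<in>X. v x ^ m x)) \<noteq> 0"
  using \<open>finite X\<close>
proof (induction X arbitrary: K rule: finite_induct)
  case empty
  then obtain m where m: "m \<in> K" by blast
  with empty have "K = {m}"
    by (auto simp: inj_on_def restrict_def)
  with empty show ?case by simp
next
  case (insert x X)
  from insert.prems obtain m0 where m0: "m0 \<in> K" by auto
  define K0 where "K0 = {m\<in>K. m x = m0 x}"
  have "inj_on (\<lambda>m. restrict m X) K0"
  proof (rule inj_onI)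
    fix m m' assume *: "m \<in> K0" "m' \<in> K0" "restrict m X = restrict m' X"
    have "restrict m (insert x X) = restrict m' (insert x X)"
    proof
      fix y show "restrict m (insert x X) y = restrict m' (insert x X) y"
        using *(1,2) fun_cong[OF *(3), of y] by (auto simp: K0_def restrict_def split: if_splits)
    qed
    then show "m = m'" by (rule inj_onD[OF insert.prems(4)]) (use * in \<open>auto simp: K0_def\<close>)
  qed
  then have "\<exists>v. (\<Sum>m\<in>K0. a m * (\<Prod>y\<in>X. v y ^ m y)) \<noteq> 0"
    by (rule insert.IH[rotated 3]) (use insert.prems(1,3) m0 in \<open>auto simp: K0_def\<close>)
  then obtain v where v: "(\<Sum>m\<in>K0. a m * (\<Prod>y\<in>X. v y ^ m y)) \<noteq> 0"
    by blast
  define p where "p = (\<Sum>m\<in>K. Polynomial.monom (a m * (\<Prod>y\<in>X. v y ^ m y)) (m x))"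
  have "Polynomial.coeff p (m0 x) = (\<Sum>m\<in>K. if m x = m0 x then a m * (\<Prod>y\<in>X. v y ^ m y) else 0)"
    by (simp add: p_def Polynomial.coeff_sum)
  also have "\<dots> = (\<Sum>m\<in>K0. a m * (\<Prod>y\<in>X. v y ^ m y))"
    unfolding K0_def using insert.prems(1) by (rule sum.inter_filter[symmetric])
  finally have "Polynomial.coeff p (m0 x) = (\<Sum>m\<in>K0. a m * (\<Prod>y\<in>X. v y ^ m y))" .
  with v have "p \<noteq> 0" by (metis Polynomial.coeff_0)
  then have "finite {t. Polynomial.poly p t = 0}"
    by (rule poly_roots_finite)
  with inf obtain t where t: "Polynomial.poly p t \<noteq> 0"
    using ex_new_if_finite by blast
  have "(\<Sum>m\<in>K. a m * (\<Prod>y\<in>insert x X. (v(x := t)) y ^ m y)) = Polynomial.poly p t"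
    unfolding p_def Polynomial.poly_sum
  proof (rule sum.cong)
    fix m
    have "(\<Prod>y\<in>X. (v(x := t)) y ^ m y) = (\<Prod>y\<in>X. v y ^ m y)"
      using insert.hyps by (intro prod.cong) auto
    then show "a m * (\<Prod>y\<in>insert x X. (v(x := t)) y ^ m y) =
        Polynomial.poly (Polynomial.monom (a m * (\<Prod>y\<in>X. v y ^ m y)) (m x)) t"
      using insert.hyps by (simp add: Polynomial.poly_monom)
  qed simp
  with t show ?case by metis
qed

lemma mpoly_eq_0_if_vanishing:
  fixes f :: "('x::finite, 'k::field) mpoly"
  assumes inf: "infinite (UNIV :: 'k set)" and van: "\<And>v. eval_at v f = 0"
  shows "f = 0"
proof (rule ccontr)
  assume "f \<noteq> 0"
  let ?K = "Poly_Mapping.lookup ` Poly_Mapping.keys f"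
  let ?a = "\<lambda>m. Poly_Mapping.lookup f (Abs_poly_mapping m)"
  have "\<exists>v. (\<Sum>m\<in>?K. ?a m * (\<Prod>x\<in>UNIV. v x ^ m x)) \<noteq> 0"
    using \<open>f \<noteq> 0\<close> by (intro nonvanishing_point[OF inf])
      (auto simp: in_keys_iff Poly_Mapping.lookup_inverse inj_on_def restrict_def)
  moreover have "(\<Sum>m\<in>?K. ?a m * (\<Prod>x\<in>UNIV. v x ^ m x)) = eval_at v f" for v
    unfolding evaluate_def
    by (subst sum.reindex) (auto simp: inj_on_def Poly_Mapping.lookup_inverse)
  ultimately show False using van by simp
qed

section \<open>Graded submodules of free modules\<close>

definition vscale :: "('x::finite, 'k::field) mpoly \<Rightarrow> (nat \<Rightarrow> ('x, 'k) mpoly) \<Rightarrow> nat \<Rightarrow> ('x, 'k) mpoly"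
  where "vscale a v = (\<lambda>k. a * v k)"

interpretation vec_module: module vscale
  by unfold_locales (auto simp: vscale_def fun_eq_iff algebra_simps)

interpretation vec_space: vector_space "\<lambda>c. vscale (Const c)"
  by unfold_locales (auto simp: vscale_def fun_eq_iff algebra_simps Const_add Const_mult)

lemma sum_fun_apply: "(sum f A) k = (\<Sum>a\<in>A. f a k)"
  by (induction A rule: infinite_finite_induct) auto

lemma vscale_apply [simp]: "vscale a v k = a * v k"
  by (simp add: vscale_def)

lemma free_module_subspace: "vec_module.subspace (free_module E)"
  by (auto simp: vec_module.subspace_def free_module_def)

definition vec_homogeneous :: "int list \<Rightarrow> int \<Rightarrow> (nat \<Rightarrow> ('x::finite, 'k::field) mpoly) \<Rightarrow> bool"
  where "vec_homogeneous E t v \<longleftrightarrow> (\<forall>k<length E. homogeneous (t - E ! k) (v k))"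

definition vec_comp :: "int list \<Rightarrow> int \<Rightarrow> (nat \<Rightarrow> ('x::finite, 'k::field) mpoly) \<Rightarrow> nat \<Rightarrow> ('x, 'k) mpoly"
  where "vec_comp E t v = (\<lambda>k. if k < length E then hcomp (t - E ! k) (v k) else 0)"

definition graded_submodule :: "int list \<Rightarrow> (nat \<Rightarrow> ('x::finite, 'k::field) mpoly) set \<Rightarrow> bool"
  where "graded_submodule E M \<longleftrightarrow>
    M \<subseteq> free_module E \<and> vec_module.subspace M \<and> (\<forall>t. \<forall>v\<in>M. vec_comp E t v \<in> M)"

lemma vec_homogeneous_0 [simp]: "vec_homogeneous E t 0"
  by (simp add: vec_homogeneous_def)

lemma vec_homogeneous_diff:
  "vec_homogeneous E t v \<Longrightarrow> vec_homogeneous E t w \<Longrightarrow> vec_homogeneous E t (v - w)"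
  by (simp add: vec_homogeneous_def homogeneous_diff)

lemma vec_homogeneous_sum:
  "(\<And>x. x \<in> A \<Longrightarrow> vec_homogeneous E t (f x)) \<Longrightarrow> vec_homogeneous E t (sum f A)"
  by (auto simp: vec_homogeneous_def sum_fun_apply intro: homogeneous_sum)

lemma vec_homogeneous_vscale:
  "homogeneous s a \<Longrightarrow> vec_homogeneous E t v \<Longrightarrow> vec_homogeneous E (s + t) (vscale a v)"
  using homogeneous_mult[of s a] by (fastforce simp: vec_homogeneous_def algebra_simps)

lemma vec_homogeneous_comp [simp]: "vec_homogeneous E t (vec_comp E t v)"
  by (simp add: vec_homogeneous_def vec_comp_def)

lemma vec_comp_free_module [simp]: "vec_comp E t v \<in> free_module E"
  by (simp add: vec_comp_def free_module_def)

lemma vec_comp_homogeneous: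
  "v \<in> free_module E \<Longrightarrow> vec_homogeneous E t v \<Longrightarrow> vec_comp E t v = v"
  by (auto simp: fun_eq_iff vec_comp_def vec_homogeneous_def free_module_def hcomp_homogeneous not_less)

lemma sum_vec_comp:
  assumes "v \<in> free_module E"
  shows "\<exists>T. finite T \<and> v = (\<Sum>t\<in>T. vec_comp E t v)"
proof -
  define T where "T = (\<Union>k<length E. (\<lambda>m. int (mdeg m) + E ! k) ` Poly_Mapping.keys (v k))"
  have *: "v k = (\<Sum>t\<in>T. vec_comp E t v k)" for k
  proof (cases "k < length E")
    case True
    have "(\<Sum>t\<in>T. hcomp (t - E ! k) (v k)) = (\<Sum>t\<in>(\<lambda>t. t - E ! k) ` T. hcomp t (v k))"
      by (subst sum.reindex) (auto simp: inj_on_def)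
    also have "\<dots> = v k"
      using True by (intro sum_hcomp) (force simp: T_def)+
    finally show ?thesis using True by (simp add: vec_comp_def)
  qed (use assms in \<open>auto simp: vec_comp_def free_module_def\<close>)
  have "v = (\<Sum>t\<in>T. vec_comp E t v)"
    by (rule ext) (simp only: sum_fun_apply *[symmetric])
  moreover have "finite T" by (simp add: T_def)
  ultimately show ?thesis by blast
qed

lemma free_hom_eq_sum:
  "(\<And>j. j < length D \<Longrightarrow> A j \<in> free_module E) \<Longrightarrow> free_hom D E A v = (\<Sum>j<length D. vscale (v j) (A j))"
  by (auto simp: fun_eq_iff free_hom_def sum_fun_apply free_module_def)

lemma free_hom_in_free_module [simp]: "free_hom D E A v \<in> free_module E"
  by (simp add: free_hom_def free_module_def)

lemma free_hom_add: "free_hom D E A (v + w) = free_hom D E A v + free_hom D E A w"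
  by (auto simp: fun_eq_iff free_hom_def sum.distrib algebra_simps)

lemma free_hom_vscale: "free_hom D E A (vscale a v) = vscale a (free_hom D E A v)"
  by (auto simp: fun_eq_iff free_hom_def sum_distrib_left algebra_simps)

lemma free_hom_0 [simp]: "free_hom D E A 0 = 0"
  by (auto simp: fun_eq_iff free_hom_def)

lemma free_hom_diff: "free_hom D E A (v - w) = free_hom D E A v - free_hom D E A w"
  by (auto simp: fun_eq_iff free_hom_def sum_subtractf algebra_simps)

lemma free_hom_sum: "free_hom D E A (sum f X) = (\<Sum>x\<in>X. free_hom D E A (f x))"
  by (induction X rule: infinite_finite_induct)
    (simp_all only: free_hom_add free_hom_0 sum.infinite sum.empty sum.insert not_False_eq_True)

lemma vec_homogeneous_free_hom:
  assumes "graded_matrix D E A" and "vec_homogeneous D t v"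
  shows "vec_homogeneous E t (free_hom D E A v)"
  unfolding vec_homogeneous_def free_hom_def
proof (intro allI impI)
  fix k assume k: "k < length E"
  have "homogeneous (t - E ! k) (v j * A j k)" if "j < length D" for j
    using homogeneous_mult[of "t - D ! j" "v j" "D ! j - E ! k" "A j k"] assms k that
    by (auto simp: graded_matrix_def vec_homogeneous_def)
  with k show "homogeneous (t - E ! k) (if k < length E then \<Sum>j<length D. v j * A j k else 0)"
    by (auto intro: homogeneous_sum)
qed

lemma vec_comp_free_hom:
  assumes "graded_matrix D E A"
  shows "vec_comp E t (free_hom D E A v) = free_hom D E A (vec_comp D t v)"
proof
  fix k
  have "hcomp (t - E ! k) (v j * A j k) = hcomp (t - D ! j) (v j) * A j k"
    if "j < length D" "k < length E" for j
    using hcomp_mult[of "D ! j - E ! k" "A j k" "t - E ! k" "v j"] assms that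
    by (simp add: graded_matrix_def)
  then show "vec_comp E t (free_hom D E A v) k = free_hom D E A (vec_comp D t v) k"
    by (simp add: vec_comp_def free_hom_def hcomp_sum)
qed

lemma image_free_hom:
  assumes "\<And>j. j < length D \<Longrightarrow> A j \<in> free_module E"
  shows "free_hom D E A ` free_module D = vec_module.span (A ` {..<length D})"
proof
  show "free_hom D E A ` free_module D \<subseteq> vec_module.span (A ` {..<length D})"
  proof (rule image_subsetI)
    fix v
    have eq: "free_hom D E A v = (\<Sum>j<length D. vscale (v j) (A j))"
      using assms by (rule free_hom_eq_sum)
    show "free_hom D E A v \<in> vec_module.span (A ` {..<length D})"
      unfolding eq by (intro vec_module.span_sum vec_module.span_scale) (simp add: vec_module.span_base)
  qed
  have "vec_module.subspace (free_hom D E A ` free_module D)"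
  proof (rule vec_module.subspaceI)
    show "0 \<in> free_hom D E A ` free_module D"
      by (rule image_eqI[of _ _ 0]) (auto simp: free_module_def)
  next
    fix x y assume "x \<in> free_hom D E A ` free_module D" "y \<in> free_hom D E A ` free_module D"
    then show "x + y \<in> free_hom D E A ` free_module D"
      by (auto simp flip: free_hom_add intro!: imageI vec_module.subspace_add[OF free_module_subspace])
  next
    fix c x assume "x \<in> free_hom D E A ` free_module D"
    then show "vscale c x \<in> free_hom D E A ` free_module D"
      by (auto simp flip: free_hom_vscale intro!: imageI vec_module.subspace_scale[OF free_module_subspace])
  qed
  moreover have "A j \<in> free_hom D E A ` free_module D" if "j < length D" for j
  proof (rule image_eqI)
    show "A j = free_hom D E A (\<lambda>i. if i = j then 1 else 0)"
      using assms[OF that] that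
      by (auto simp: fun_eq_iff free_hom_def free_module_def if_distrib[of "\<lambda>x. x * _"] cong: if_cong)
    show "(\<lambda>i. if i = j then 1 else 0) \<in> free_module D"
      using that by (auto simp: free_module_def)
  qed
  ultimately show "vec_module.span (A ` {..<length D}) \<subseteq> free_hom D E A ` free_module D"
    by (intro vec_module.span_minimal) auto
qed

lemma graded_submodule_kernel:
  assumes "graded_matrix D E A"
  shows "graded_submodule D {v \<in> free_module D. free_hom D E A v = 0}"
  unfolding graded_submodule_def
proof (intro conjI allI ballI)
  show "vec_module.subspace {v \<in> free_module D. free_hom D E A v = 0}"
    using free_module_subspace[of D]
    by (auto simp: vec_module.subspace_def free_hom_add free_hom_vscale)
  fix t v assume "v \<in> {v \<in> free_module D. free_hom D E A v = 0}"
  then show "vec_comp D t v \<in> {v \<in> free_module D. free_hom D E A v = 0}"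
    by (auto simp: vec_comp_free_hom[OF assms, symmetric]) (auto simp: vec_comp_def)
qed auto

section \<open>Koszul complexes\<close>

declare One_nat_def [simp del]

definition var_index :: "'x::finite \<Rightarrow> nat"
  where "var_index = (SOME f. inj f)"

lemma inj_var_index: "inj (var_index :: 'x::finite \<Rightarrow> nat)"
proof -
  have "\<exists>f :: 'x \<Rightarrow> nat. inj f"
    using finite_imp_inj_to_nat_seg[of "UNIV :: 'x set"] by auto
  then show ?thesis unfolding var_index_def by (rule someI_ex)
qed

definition koszul_sign :: "'x::finite \<Rightarrow> 'x set \<Rightarrow> 'k::field"
  where "koszul_sign x T = (- 1) ^ card {y\<in>T. var_index y < var_index x}"

lemma koszul_sign_square [simp]: "koszul_sign x T * koszul_sign x T = 1"
  by (simp add: koszul_sign_def flip: power_mult_distrib)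

lemma koszul_sign_insert:
  assumes "x \<notin> T"
  shows "koszul_sign y (insert x T) =
    (if var_index x < var_index y then - koszul_sign y T else koszul_sign y T)"
proof -
  have "{z \<in> insert x T. var_index z < var_index y} =
      (if var_index x < var_index y then insert x {z\<in>T. var_index z < var_index y}
       else {z\<in>T. var_index z < var_index y})"
    by auto
  then show ?thesis using assms by (auto simp: koszul_sign_def)
qed

lemma koszul_sign_swap:
  assumes "x \<notin> T" "y \<notin> T" "x \<noteq> y"
  shows "koszul_sign x T * koszul_sign y (insert x T) = - (koszul_sign y T * koszul_sign x (insert y T))"
proof -
  have "var_index x \<noteq> var_index y"
    using assms(3) inj_var_index by (auto dest: injD)
  then show ?thesis using assms by (auto simp: koszul_sign_insert)
qed

text \<open>
  The value \<open>z T\<close> is the coefficient of the exterior product \<open>e\<^sub>T\<close> of the basis vectors indexed by \<open>T\<close>,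
  so this is the differential of the Koszul complex of the variables with coefficients in a module of
  vectors. The total order behind the signs is the arbitrary one given by \<open>var_index\<close>.
\<close>

definition koszul_diff :: "('x::finite set \<Rightarrow> nat \<Rightarrow> ('x, 'k::field) mpoly) \<Rightarrow> 'x set \<Rightarrow> nat \<Rightarrow> ('x, 'k) mpoly"
  where "koszul_diff z T = (\<Sum>x\<in>- T. vscale (Const (koszul_sign x T) * Var x) (z (insert x T)))"

text \<open>
  Pairing \<open>(x, y)\<close> with \<open>(y, x)\<close> is needed: that the sum equals its own negative would say nothing in
  characteristic 2.
\<close>

lemma sum_antisymmetric:
  fixes F :: "'x::finite \<Rightarrow> 'x \<Rightarrow> 'a::ab_group_add"
  assumes "\<And>x y. x \<in> X \<Longrightarrow> y \<in> X \<Longrightarrow> x \<noteq> y \<Longrightarrow> F x y = - F y x"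
  shows "(\<Sum>x\<in>X. \<Sum>y\<in>X - {x}. F x y) = 0"
proof -
  define L where "L = {(x, y). x \<in> X \<and> y \<in> X \<and> var_index x < var_index y}"
  have neq: "x \<noteq> y \<longleftrightarrow> var_index x < var_index y \<or> var_index y < var_index x" for x y :: 'x
    using inj_var_index by (metis injD linorder_neq_iff)
  have swap: "prod.swap ` L = {(x, y). x \<in> X \<and> y \<in> X \<and> var_index y < var_index x}"
    by (auto simp: L_def image_iff)
  have eq: "(SIGMA x:X. X - {x}) = L \<union> prod.swap ` L"
  proof (rule Set.set_eqI)
    fix p :: "'x \<times> 'x"
    obtain x y where p: "p = (x, y)" by (cases p)
    show "p \<in> (SIGMA x:X. X - {x}) \<longleftrightarrow> p \<in> L \<union> prod.swap ` L"
      unfolding swap p using neq[of x y] neq[of y x] by (auto simp: L_def)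
  qed
  have disj: "L \<inter> prod.swap ` L = {}"
    unfolding swap by (auto simp: L_def)
  have "(\<Sum>x\<in>X. \<Sum>y\<in>X - {x}. F x y) = (\<Sum>(x, y)\<in>L \<union> prod.swap ` L. F x y)"
    unfolding eq[symmetric] by (rule sum.Sigma) auto
  also have "\<dots> = (\<Sum>(x, y)\<in>L. F x y) + (\<Sum>(x, y)\<in>prod.swap ` L. F x y)"
    by (rule sum.union_disjoint) (use disj in auto)
  also have "(\<Sum>(x, y)\<in>prod.swap ` L. F x y) = (\<Sum>(x, y)\<in>L. F y x)"
    by (subst sum.reindex) (auto simp: case_prod_beta intro!: inj_onI)
  also have "\<dots> = (\<Sum>(x, y)\<in>L. - F x y)"
  proof (rule sum.cong)
    fix p assume "p \<in> L"
    then show "(case p of (x, y) \<Rightarrow> F y x) = (case p of (x, y) \<Rightarrow> - F x y)"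
      by (auto simp: L_def intro!: assms)
  qed simp
  finally show ?thesis by (simp add: case_prod_beta sum_negf)
qed

lemma koszul_diff_diff: "koszul_diff (koszul_diff z) = (\<lambda>_. 0)"
proof
  fix T
  have "koszul_diff (koszul_diff z) T = (\<Sum>x\<in>-T. \<Sum>y\<in>-T-{x}.
      vscale (Const (koszul_sign x T * koszul_sign y (insert x T)) * (Var x * Var y)) (z (insert x (insert y T))))"
    unfolding koszul_diff_def vec_module.scale_sum_right
    by (intro sum.cong) (auto simp: Const_mult algebra_simps insert_commute)
  also have "\<dots> = 0"
  proof (rule sum_antisymmetric)
    fix x y assume "x \<in> - T" "y \<in> - T" "x \<noteq> y"
    then have "koszul_sign x T * koszul_sign y (insert x T) = - (koszul_sign y T * koszul_sign x (insert y T) :: 'b)"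
      by (intro koszul_sign_swap) auto
    then show "vscale (Const (koszul_sign x T * koszul_sign y (insert x T)) * (Var x * Var y)) (z (insert x (insert y T))) =
        - vscale (Const (koszul_sign y T * koszul_sign x (insert y T)) * (Var y * Var x)) (z (insert y (insert x T)))"
      by (simp add: Const_minus insert_commute mult.commute)
  qed
  finally show "koszul_diff (koszul_diff z) T = 0" .
qed

lemma koszul_diff_diff_chains: "koszul_diff (\<lambda>T. z T - w T) = (\<lambda>T. koszul_diff z T - koszul_diff w T)"
  by (auto simp: koszul_diff_def vec_module.scale_right_diff_distrib sum_subtractf)

lemma free_hom_koszul_diff: "free_hom D E A (koszul_diff z T) = koszul_diff (\<lambda>T. free_hom D E A (z T)) T"
  by (simp add: koszul_diff_def free_hom_sum free_hom_vscale)

lemma lookup_koszul_diff: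
  "Poly_Mapping.lookup (koszul_diff z T k) m = (\<Sum>x\<in>-T. koszul_sign x T *
    (if Poly_Mapping.lookup m x > 0 then Poly_Mapping.lookup (z (insert x T) k) (m - Poly_Mapping.single x 1) else 0))"
  by (simp add: koszul_diff_def sum_fun_apply lookup_sum mult.assoc lookup_Var_mult)

subsection \<open>A contracting homotopy\<close>

text \<open>
  The Koszul complex of the polynomial ring splits by multidegree, where the term \<open>x^m e\<^sub>T\<close> has multidegree
  \<open>m + support_monomial T\<close>. The part of multidegree \<open>a\<close> is the augmented chain complex of the full simplex on the
  variables occurring in \<open>a\<close>. It is contracted by the cone over one vertex, which may be chosen freely
  for each \<open>a \<noteq> 0\<close>. The homotopy below moves this vertex from the monomial into the set \<open>T\<close>. It uses
  no division, so the characteristic of the field does not matter.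
\<close>

definition support_monomial :: "'x::finite set \<Rightarrow> 'x \<Rightarrow>\<^sub>0 nat"
  where "support_monomial T = (\<Sum>x\<in>T. Poly_Mapping.single x 1)"

definition some_variable :: "('x::finite \<Rightarrow>\<^sub>0 nat) \<Rightarrow> 'x"
  where "some_variable a = (SOME x. Poly_Mapping.lookup a x > 0)"

definition koszul_homotopy :: "('x::finite set \<Rightarrow> nat \<Rightarrow> ('x, 'k::field) mpoly) \<Rightarrow> 'x set \<Rightarrow> nat \<Rightarrow> ('x, 'k) mpoly"
  where "koszul_homotopy z T k = Abs_poly_mapping (\<lambda>m. let u = some_variable (m + support_monomial T) in
    if u \<in> T then koszul_sign u (T - {u}) * Poly_Mapping.lookup (z (T - {u}) k) (m + Poly_Mapping.single u 1) else 0)"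

lemma lookup_support_monomial: "Poly_Mapping.lookup (support_monomial T) x = (if x \<in> T then 1 else 0)"
  by (simp add: support_monomial_def lookup_sum lookup_single when_def)

lemma lookup_some_variable: "a \<noteq> 0 \<Longrightarrow> Poly_Mapping.lookup a (some_variable a) > 0"
  unfolding some_variable_def by (rule someI_ex) (auto simp: poly_mapping_eq_iff fun_eq_iff)

lemma lookup_koszul_homotopy:
  "Poly_Mapping.lookup (koszul_homotopy z T k) m = (let u = some_variable (m + support_monomial T) in
    if u \<in> T then koszul_sign u (T - {u}) * Poly_Mapping.lookup (z (T - {u}) k) (m + Poly_Mapping.single u 1) else 0)"
  (is "_ = ?g m")
proof -
  have "{m. ?g m \<noteq> 0} \<subseteq> (\<Union>u\<in>T. (\<lambda>m. m + Poly_Mapping.single u 1) -` Poly_Mapping.keys (z (T - {u}) k))"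
    by (auto simp: Let_def in_keys_iff split: if_splits)
  moreover have "finite (\<Union>u\<in>T. (\<lambda>m. m + Poly_Mapping.single u 1) -` Poly_Mapping.keys (z (T - {u}) k))"
    by (intro finite_UN_I finite_vimageI) (auto simp: inj_on_def)
  ultimately have "finite {m. ?g m \<noteq> 0}" by (rule finite_subset)
  then show ?thesis unfolding koszul_homotopy_def by (subst lookup_Abs_poly_mapping) auto
qed

lemma koszul_homotopy_nonzero:
  assumes "Poly_Mapping.lookup (koszul_homotopy z T k) m \<noteq> 0"
  obtains u where "u \<in> T" "Poly_Mapping.lookup (z (T - {u}) k) (m + Poly_Mapping.single u 1) \<noteq> 0"
  using assms by (auto simp: lookup_koszul_homotopy Let_def split: if_splits)

text \<open>
  The condition on the constant coefficients excludes multidegree \<open>0\<close>, the only one in which the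
  complex has homology. It holds automatically in positive homological degree, and for a
  single vector it says that all entries lie in \<open>\<mm>\<close>.
\<close>

lemma koszul_exact:
  fixes z :: "'x::finite set \<Rightarrow> nat \<Rightarrow> ('x, 'k::field) mpoly"
  assumes cycle: "koszul_diff z = (\<lambda>_. 0)" and z0: "\<And>k. Poly_Mapping.lookup (z {} k) 0 = 0"
  shows "koszul_diff (koszul_homotopy z) = z"
proof (intro ext poly_mapping_eqI)
  fix T :: "'x set" and k m
  define a where "a = m + support_monomial T"
  define u where "u = some_variable a"
  let ?c = "\<lambda>T. Poly_Mapping.lookup (z T k)"
  let ?h = "\<lambda>T. Poly_Mapping.lookup (koszul_homotopy z T k)"
  let ?e = "\<lambda>x::'x. Poly_Mapping.single x (1::nat)"
  have shift: "m - ?e x + support_monomial (insert x T) = a" if "x \<notin> T" "Poly_Mapping.lookup m x > 0" for x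
    unfolding a_def using that
    by (intro poly_mapping_eqI) (auto simp: lookup_add lookup_minus lookup_support_monomial lookup_single when_def)
  have lhs: "Poly_Mapping.lookup (koszul_diff (koszul_homotopy z) T k) m =
    (\<Sum>x\<in>-T. koszul_sign x T * (if Poly_Mapping.lookup m x > 0 then
      if u \<in> insert x T then koszul_sign u (insert x T - {u}) * ?c (insert x T - {u}) (m - ?e x + ?e u) else 0 else 0))"
    unfolding lookup_koszul_diff
  proof (intro sum.cong refl)
    fix x assume x: "x \<in> - T"
    have "?h (insert x T) (m - ?e x) =
        (if u \<in> insert x T then koszul_sign u (insert x T - {u}) * ?c (insert x T - {u}) (m - ?e x + ?e u) else 0)"
      if "Poly_Mapping.lookup m x > 0"
      unfolding lookup_koszul_homotopy shift[OF _ that, OF x[unfolded Compl_iff]] Let_def u_def[symmetric] by (rule refl)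
    then show "koszul_sign x T * (if Poly_Mapping.lookup m x > 0 then ?h (insert x T) (m - ?e x) else 0) =
      koszul_sign x T * (if Poly_Mapping.lookup m x > 0 then
        if u \<in> insert x T then koszul_sign u (insert x T - {u}) * ?c (insert x T - {u}) (m - ?e x + ?e u) else 0 else 0)"
      by simp
  qed
  show "Poly_Mapping.lookup (koszul_diff (koszul_homotopy z) T k) m = ?c T m"
  proof (cases "a = 0")
    case True
    have m: "Poly_Mapping.lookup m x = 0" "x \<notin> T" for x
      using arg_cong[OF True, of "\<lambda>a. Poly_Mapping.lookup a x"]
      by (auto simp: a_def lookup_add lookup_support_monomial split: if_splits)
    then have "m = 0" "T = {}" by (auto intro: poly_mapping_eqI)
    then show ?thesis unfolding lhs by (simp add: z0)
  next
    case False
    then have au: "Poly_Mapping.lookup a u > 0" unfolding u_def by (rule lookup_some_variable)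
    show ?thesis
    proof (cases "u \<in> T")
      case uT: False
      with au have mu: "Poly_Mapping.lookup m u > 0"
        by (simp add: a_def lookup_add lookup_support_monomial)
      have "Poly_Mapping.lookup (koszul_diff (koszul_homotopy z) T k) m =
          (\<Sum>x\<in>-T. if x = u then koszul_sign u T * (koszul_sign u T * ?c T m) else 0)"
        unfolding lhs using uT mu monomial_minus_add[OF mu]
        by (intro sum.cong) (auto simp: add.commute)
      also have "\<dots> = ?c T m"
        using uT by (simp flip: mult.assoc)
      finally show ?thesis .
    next
      case uT: True
      define T' where "T' = T - {u}"
      have T: "T = insert u T'" "u \<notin> T'" using uT by (auto simp: T'_def)
      have swap: "m - ?e x + ?e u = m + ?e u - ?e x" if "Poly_Mapping.lookup m x > 0" for x
        using that by (intro poly_mapping_eqI) (auto simp: lookup_add lookup_minus lookup_single when_def)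
      define S where "S = (\<Sum>x\<in>-T. koszul_sign x T' *
        (if Poly_Mapping.lookup m x > 0 then ?c (insert x T') (m + ?e u - ?e x) else 0))"
      have "0 = Poly_Mapping.lookup (koszul_diff z T' k) (m + ?e u)"
        by (simp add: cycle)
      also have "- T' = insert u (- T)"
        using T by auto
      then have "Poly_Mapping.lookup (koszul_diff z T' k) (m + ?e u) = koszul_sign u T' * ?c T m +
        (\<Sum>x\<in>-T. koszul_sign x T' * (if Poly_Mapping.lookup (m + ?e u) x > 0 then ?c (insert x T') (m + ?e u - ?e x) else 0))"
        unfolding lookup_koszul_diff by (simp add: T(1) lookup_add)
      also have "(\<Sum>x\<in>-T. koszul_sign x T' *
          (if Poly_Mapping.lookup (m + ?e u) x > 0 then ?c (insert x T') (m + ?e u - ?e x) else 0)) = S"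
        unfolding S_def by (intro sum.cong) (auto simp: lookup_add lookup_single when_def T(1))
      finally have S: "S = - (koszul_sign u T' * ?c T m)"
        by (simp add: eq_neg_iff_add_eq_0 add.commute)
      have "Poly_Mapping.lookup (koszul_diff (koszul_homotopy z) T k) m =
        (\<Sum>x\<in>-T. - koszul_sign u T' * (koszul_sign x T' *
          (if Poly_Mapping.lookup m x > 0 then ?c (insert x T') (m + ?e u - ?e x) else 0)))"
        unfolding lhs
      proof (intro sum.cong)
        fix x assume x: "x \<in> - T"
        then have xT: "insert x T - {u} = insert x T'" "x \<noteq> u" "x \<notin> T'" using T by auto
        have "koszul_sign u T' * koszul_sign x T = - (koszul_sign x T' * koszul_sign u (insert x T') :: 'k)"
          unfolding T(1) using xT T(2) by (intro koszul_sign_swap) auto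
        then have "koszul_sign u T' * (koszul_sign u T' * koszul_sign x T) * koszul_sign u (insert x T')
          = - koszul_sign u T' * (koszul_sign x T' * (koszul_sign u (insert x T') * koszul_sign u (insert x T')) :: 'k)"
          by simp
        then have sg: "koszul_sign x T * koszul_sign u (insert x T') = - koszul_sign u T' * (koszul_sign x T' :: 'k)"
          by (simp flip: mult.assoc)
        show "koszul_sign x T * (if Poly_Mapping.lookup m x > 0 then
            if u \<in> insert x T then koszul_sign u (insert x T - {u}) * ?c (insert x T - {u}) (m - ?e x + ?e u) else 0 else 0) =
          - koszul_sign u T' * (koszul_sign x T' *
            (if Poly_Mapping.lookup m x > 0 then ?c (insert x T') (m + ?e u - ?e x) else 0))"
          using uT sg by (auto simp: xT(1) swap simp flip: mult.assoc)
      qed simp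
      also have "\<dots> = - koszul_sign u T' * S"
        by (simp only: S_def sum_distrib_left)
      also have "\<dots> = ?c T m"
        by (simp add: S flip: mult.assoc)
      finally show ?thesis .
    qed
  qed
qed

text \<open>
  Here \<open>t\<close> is the degree of the coefficient vectors, not the total degree \<open>t + p\<close>. The differential
  therefore lowers \<open>p\<close> and raises \<open>t\<close> by one.
\<close>

definition koszul_chain :: "int list \<Rightarrow> (nat \<Rightarrow> ('x::finite, 'k::field) mpoly) set \<Rightarrow> nat \<Rightarrow> int \<Rightarrow>
    ('x set \<Rightarrow> nat \<Rightarrow> ('x, 'k) mpoly) \<Rightarrow> bool"
  where "koszul_chain E M p t z \<longleftrightarrow>
    (\<forall>T. z T \<in> M \<and> vec_homogeneous E t (z T)) \<and> (\<forall>T. card T \<noteq> p \<longrightarrow> z T = 0)"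

definition koszul_acyclic :: "int list \<Rightarrow> (nat \<Rightarrow> ('x::finite, 'k::field) mpoly) set \<Rightarrow> nat \<Rightarrow> int \<Rightarrow> bool"
  where "koszul_acyclic E M p t \<longleftrightarrow>
    (\<forall>z. koszul_chain E M p t z \<longrightarrow> koszul_diff z = (\<lambda>_. 0) \<longrightarrow>
      (\<exists>w. koszul_chain E M (Suc p) (t - 1) w \<and> koszul_diff w = z))"

lemma koszul_chain_homotopy:
  assumes "koszul_chain E (free_module E) p t z"
  shows "koszul_chain E (free_module E) (Suc p) (t - 1) (koszul_homotopy z)"
  unfolding koszul_chain_def
proof (intro conjI allI impI)
  fix T
  show "koszul_homotopy z T \<in> free_module E"
    unfolding free_module_def
  proof (intro CollectI allI impI poly_mapping_eqI, rule ccontr)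
    fix k m assume k: "length E \<le> k" and "Poly_Mapping.lookup (koszul_homotopy z T k) m \<noteq> Poly_Mapping.lookup 0 m"
    then obtain u where "Poly_Mapping.lookup (z (T - {u}) k) (m + Poly_Mapping.single u 1) \<noteq> 0"
      by (auto elim: koszul_homotopy_nonzero)
    moreover have "z (T - {u}) k = 0"
      using assms k by (auto simp: koszul_chain_def free_module_def)
    ultimately show False by simp
  qed
  show "vec_homogeneous E (t - 1) (koszul_homotopy z T)"
    unfolding vec_homogeneous_def homogeneous_lookup
  proof (intro allI impI)
    fix k m assume k: "k < length E" and "Poly_Mapping.lookup (koszul_homotopy z T k) m \<noteq> 0"
    then obtain u where "Poly_Mapping.lookup (z (T - {u}) k) (m + Poly_Mapping.single u 1) \<noteq> 0"
      by (auto elim: koszul_homotopy_nonzero)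
    moreover have "homogeneous (t - E ! k) (z (T - {u}) k)"
      using assms k by (auto simp: koszul_chain_def vec_homogeneous_def)
    ultimately have "int (mdeg (m + Poly_Mapping.single u 1)) = t - E ! k"
      by (simp add: homogeneous_lookup)
    then show "int (mdeg m) = t - 1 - E ! k"
      by (simp add: mdeg_add)
  qed
  assume T: "card T \<noteq> Suc p"
  show "koszul_homotopy z T = 0"
  proof (intro ext poly_mapping_eqI, rule ccontr)
    fix k m assume "Poly_Mapping.lookup (koszul_homotopy z T k) m \<noteq> Poly_Mapping.lookup (0 k) m"
    then obtain u where u: "u \<in> T" "Poly_Mapping.lookup (z (T - {u}) k) (m + Poly_Mapping.single u 1) \<noteq> 0"
      by (auto elim: koszul_homotopy_nonzero)
    then have "z (T - {u}) \<noteq> 0" by auto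
    then have "card (T - {u}) = p" using assms by (auto simp: koszul_chain_def)
    with u T show False by (metis card_Suc_Diff1 finite)
  qed
qed

section \<open>Minimal generators and syzygies\<close>

lemma koszul_acyclicD:
  assumes "koszul_acyclic E M p t" "koszul_chain E M p t z" "koszul_diff z = (\<lambda>_. 0)"
  obtains w where "koszul_chain E M (Suc p) (t - 1) w" "koszul_diff w = z"
  using assms unfolding koszul_acyclic_def by metis

text \<open>
  The connecting homomorphism of the short exact sequence of Koszul complexes of the kernel, the free
  module and \<open>M\<close>, made explicit: a cycle \<open>z\<close> of the kernel bounds some \<open>w\<close> over the free module, the
  image of \<open>w\<close> is a cycle over \<open>M\<close> and bounds some \<open>u\<close>, and subtracting from \<open>w\<close> the boundary of a lift of
  \<open>u\<close> moves \<open>w\<close> into the kernel. Minimality is what makes the first step possible also in homological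
  degree \<open>0\<close>.
\<close>

lemma koszul_acyclic_syzygies:
  fixes M :: "(nat \<Rightarrow> ('x::finite, 'k::field) mpoly) set"
  assumes acyclic: "koszul_acyclic E M (Suc p) (t - 1)" and A: "graded_matrix D E A"
    and image: "free_hom D E A ` free_module D = M"
    and minimal: "\<And>v k. v \<in> free_module D \<Longrightarrow> free_hom D E A v = 0 \<Longrightarrow> Poly_Mapping.lookup (v k) 0 = 0"
  shows "koszul_acyclic D {v \<in> free_module D. free_hom D E A v = 0} p t"
  unfolding koszul_acyclic_def
proof (intro allI impI)
  let ?K = "{v \<in> free_module D. free_hom D E A v = 0}" and ?A = "free_hom D E A"
  fix z :: "'x set \<Rightarrow> nat \<Rightarrow> ('x, 'k) mpoly"
  assume z: "koszul_chain D ?K p t z" and cycle: "koszul_diff z = (\<lambda>_. 0)"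
  define w where "w = koszul_homotopy z"
  have Az: "?A (z T) = 0" for T
    using z by (auto simp: koszul_chain_def)
  have "koszul_chain D (free_module D) p t z"
    using z by (auto simp: koszul_chain_def)
  then have w: "koszul_chain D (free_module D) (Suc p) (t - 1) w"
    unfolding w_def by (rule koszul_chain_homotopy)
  have dw: "koszul_diff w = z"
    unfolding w_def using z by (intro koszul_exact cycle minimal) (auto simp: koszul_chain_def)
  have Aw: "koszul_chain E M (Suc p) (t - 1) (\<lambda>T. ?A (w T))"
    using w vec_homogeneous_free_hom[OF A] by (auto simp: koszul_chain_def simp flip: image)
  have dAw: "koszul_diff (\<lambda>T. ?A (w T)) = (\<lambda>_. 0)"
    unfolding free_hom_koszul_diff[symmetric] dw Az by (rule refl)
  obtain u where u: "koszul_chain E M (Suc (Suc p)) (t - 1 - 1) u" "koszul_diff u = (\<lambda>T. ?A (w T))"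
    by (rule koszul_acyclicD[OF acyclic Aw dAw])
  have "\<exists>v. v \<in> free_module D \<and> vec_homogeneous D (t - 1 - 1) v \<and> ?A v = u T \<and> (card T \<noteq> Suc (Suc p) \<longrightarrow> v = 0)" for T
  proof (cases "card T = Suc (Suc p)")
    case True
    have "u T \<in> M" and uh: "vec_homogeneous E (t - 1 - 1) (u T)"
      using u(1) by (auto simp: koszul_chain_def)
    have "u T \<in> ?A ` free_module D"
      unfolding image by fact
    then obtain v where v: "v \<in> free_module D" "?A v = u T"
      by (auto elim: imageE)
    have "?A (vec_comp D (t - 1 - 1) v) = vec_comp E (t - 1 - 1) (u T)"
      unfolding v(2)[symmetric] by (rule vec_comp_free_hom[OF A, symmetric])
    also have "\<dots> = u T"
      using free_hom_in_free_module[of D E A v] unfolding v(2) by (rule vec_comp_homogeneous[OF _ uh])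
    finally show ?thesis using True by (intro exI[of _ "vec_comp D (t - 1 - 1) v"]) simp
  next
    case False
    then have "u T = 0" using u(1) by (auto simp: koszul_chain_def)
    with False show ?thesis
      by (intro exI[of _ 0]) (simp add: free_module_def)
  qed
  then obtain v where v: "\<And>T. v T \<in> free_module D" "\<And>T. vec_homogeneous D (t - 1 - 1) (v T)"
      "\<And>T. ?A (v T) = u T" "\<And>T. card T \<noteq> Suc (Suc p) \<Longrightarrow> v T = 0"
    by metis
  define w' where "w' = (\<lambda>T. w T - koszul_diff v T)"
  have dv: "koszul_diff v T \<in> free_module D" for T
    unfolding koszul_diff_def
    by (intro vec_module.subspace_sum vec_module.subspace_scale free_module_subspace v(1))
  have hv: "vec_homogeneous D (t - 1) (koszul_diff v T)" for T
    unfolding koszul_diff_def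
  proof (rule vec_homogeneous_sum)
    fix x :: 'x
    have "vec_homogeneous D (0 + 1 + (t - 1 - 1)) (vscale (Const (koszul_sign x T) * Var x) (v (insert x T)))"
      by (intro vec_homogeneous_vscale homogeneous_mult v) auto
    then show "vec_homogeneous D (t - 1) (vscale (Const (koszul_sign x T) * Var x) (v (insert x T)))"
      by simp
  qed
  have cv: "koszul_diff v T = 0" if "card T \<noteq> Suc p" for T
    unfolding koszul_diff_def
  proof (intro sum.neutral ballI)
    fix x assume "x \<in> - T"
    then have "card (insert x T) \<noteq> Suc (Suc p)" using that by simp
    then have "v (insert x T) = 0" by (rule v(4))
    then show "vscale (Const (koszul_sign x T) * Var x) (v (insert x T)) = 0" by simp
  qed
  have "?A (w' T) = 0" for T
    using fun_cong[OF u(2), of T] unfolding w'_def free_hom_diff free_hom_koszul_diff v(3) by simp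
  then have "koszul_chain D ?K (Suc p) (t - 1) w'"
    using w dv hv cv
    by (auto simp: koszul_chain_def w'_def
        intro!: vec_homogeneous_diff vec_module.subspace_diff[OF free_module_subspace])
  moreover have "koszul_diff w' = z"
    unfolding w'_def koszul_diff_diff_chains dw koszul_diff_diff by (auto simp: fun_eq_iff)
  ultimately show "\<exists>w. koszul_chain D ?K (Suc p) (t - 1) w \<and> koszul_diff w = z"
    by blast
qed

text \<open>
  Graded Nakayama: acyclicity in homological degree \<open>0\<close> says that every homogeneous vector of degree
  \<open>t > c\<close> is a combination of vectors of degree \<open>t - 1\<close> with the variables as coefficients.
\<close>

lemma generated_in_low_degree:
  fixes M :: "(nat \<Rightarrow> ('x::finite, 'k::field) mpoly) set"
  assumes M: "graded_submodule E M" and acyclic: "\<And>t. t > c \<Longrightarrow> koszul_acyclic E M 0 t"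
  shows "vec_module.span {v \<in> M. \<exists>t\<le>c. vec_homogeneous E t v} = M"
proof
  let ?N = "vec_module.span {v \<in> M. \<exists>t\<le>c. vec_homogeneous E t v}"
  show "?N \<subseteq> M"
    using M by (intro vec_module.span_minimal) (auto simp: graded_submodule_def)
  have hom: "v \<in> ?N" if "v \<in> M" "vec_homogeneous E t v" for v t
    using that
  proof (induction "nat (t - c)" arbitrary: t v)
    case 0
    then show ?case by (intro vec_module.span_base) auto
  next
    case (Suc n)
    define z where "z = (\<lambda>T::'x set. if T = {} then v else 0)"
    have 0: "0 \<in> M" using M vec_module.subspace_0 by (auto simp: graded_submodule_def)
    have z: "koszul_chain E M 0 t z"
      using Suc.prems 0 by (auto simp: koszul_chain_def z_def)
    have dz: "koszul_diff z = (\<lambda>_. 0)"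
      by (simp add: fun_eq_iff koszul_diff_def z_def)
    have "koszul_acyclic E M 0 t" using Suc.hyps(2) by (intro acyclic) simp
    then obtain w where w: "koszul_chain E M (Suc 0) (t - 1) w" "koszul_diff w = z"
      by (rule koszul_acyclicD[OF _ z dz])
    have "v = koszul_diff w {}" using w(2) by (simp add: z_def)
    also have "\<dots> \<in> ?N"
      unfolding koszul_diff_def
    proof (intro vec_module.span_sum vec_module.span_scale Suc.hyps(1)[of "t - 1"])
      show "n = nat (t - 1 - c)" using Suc.hyps(2) by simp
    qed (use w(1) in \<open>auto simp: koszul_chain_def\<close>)
    finally show ?case .
  qed
  show "M \<subseteq> ?N"
  proof
    fix v assume "v \<in> M"
    then have "v \<in> free_module E" using M by (auto simp: graded_submodule_def)
    then obtain T where T: "v = (\<Sum>t\<in>T. vec_comp E t v)"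
      using sum_vec_comp by blast
    have "(\<Sum>t\<in>T. vec_comp E t v) \<in> ?N"
      using M \<open>v \<in> M\<close> by (intro vec_module.span_sum hom[OF _ vec_homogeneous_comp]) (auto simp: graded_submodule_def)
    with T show "v \<in> ?N" by metis
  qed
qed

lemma finite_monomials: "finite {m :: 'x::finite \<Rightarrow>\<^sub>0 nat. int (mdeg m) \<le> N}"
proof -
  have le: "Poly_Mapping.lookup m x \<le> mdeg m" for m :: "'x \<Rightarrow>\<^sub>0 nat" and x
    unfolding mdeg_def by (rule member_le_sum) auto
  have "Poly_Mapping.lookup ` {m :: 'x \<Rightarrow>\<^sub>0 nat. int (mdeg m) \<le> N} \<subseteq> PiE UNIV (\<lambda>_. {..nat N})"
  proof
    fix f assume "f \<in> Poly_Mapping.lookup ` {m :: 'x \<Rightarrow>\<^sub>0 nat. int (mdeg m) \<le> N}"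
    then obtain m where m: "f = Poly_Mapping.lookup m" "int (mdeg m) \<le> N" by auto
    have "Poly_Mapping.lookup m x \<le> nat N" for x
      using le[of m x] m(2) by linarith
    then show "f \<in> PiE UNIV (\<lambda>_. {..nat N})" by (auto simp: m(1))
  qed
  moreover have "finite (PiE (UNIV :: 'x set) (\<lambda>_. {..nat N}))"
    by (rule finite_PiE) auto
  ultimately have "finite (Poly_Mapping.lookup ` {m :: 'x \<Rightarrow>\<^sub>0 nat. int (mdeg m) \<le> N})"
    by (rule finite_subset)
  then show ?thesis by (rule finite_imageD) (simp add: inj_on_def)
qed

text \<open>
  Only finitely many monomial vectors have degree at most \<open>c\<close>, so the vectors in question span a space
  of finite dimension over the field. This replaces Hilbert's basis theorem.
\<close>

lemma finite_low_degree_generators: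
  fixes H :: "(nat \<Rightarrow> ('x::finite, 'k::field) mpoly) set"
  assumes H: "\<And>v. v \<in> H \<Longrightarrow> v \<in> free_module E \<and> (\<exists>t\<le>c. vec_homogeneous E t v)"
  obtains B where "finite B" "B \<subseteq> H" "H \<subseteq> vec_module.span B"
proof -
  define mon where "mon = (\<lambda>(j :: nat, m) k. if k = j then Poly_Mapping.single m (1::'k) else (0 :: ('x, 'k) mpoly))"
  define S where "S = (SIGMA j:{..<length E}. {m :: 'x \<Rightarrow>\<^sub>0 nat. int (mdeg m) \<le> c - E ! j})"
  have "finite S" unfolding S_def by (intro finite_SigmaI finite_monomials) auto
  obtain B where B: "B \<subseteq> H" "vec_space.independent B" "H \<subseteq> vec_space.span B"
    using vec_space.maximal_independent_subset[of H] by blast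
  have "v \<in> vec_space.span (mon ` S)" if v: "v \<in> free_module E" "vec_homogeneous E t v" "t \<le> c" for v t
  proof -
    have "v = (\<Sum>j<length E. \<Sum>m\<in>Poly_Mapping.keys (v j). vscale (Const (Poly_Mapping.lookup (v j) m)) (mon (j, m)))"
    proof
      fix k
      have "(\<Sum>m\<in>Poly_Mapping.keys (v j). vscale (Const (Poly_Mapping.lookup (v j) m)) (mon (j, m)) k) =
        (if k = j then v j else 0)" for j
        by (auto simp: mon_def poly_mapping_sum_singles single_eq_Const_mult[symmetric])
      then have "(\<Sum>j<length E. \<Sum>m\<in>Poly_Mapping.keys (v j). vscale (Const (Poly_Mapping.lookup (v j) m)) (mon (j, m))) k =
        (\<Sum>j<length E. if k = j then v j else 0)"
        by (simp only: sum_fun_apply)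
      also have "\<dots> = v k"
        using v(1) by (auto simp: free_module_def)
      finally show "v k = (\<Sum>j<length E. \<Sum>m\<in>Poly_Mapping.keys (v j). vscale (Const (Poly_Mapping.lookup (v j) m)) (mon (j, m))) k" ..
    qed
    also have "\<dots> \<in> vec_space.span (mon ` S)"
    proof (intro vec_space.span_sum vec_space.span_scale)
      fix j m assume "j \<in> {..<length E}" "m \<in> Poly_Mapping.keys (v j)"
      then have "(j, m) \<in> S" using v(2,3) by (auto simp: S_def vec_homogeneous_def homogeneous_def)
      then show "mon (j, m) \<in> vec_space.span (mon ` S)" by (intro vec_space.span_base imageI)
    qed
    finally show ?thesis .
  qed
  then have "B \<subseteq> vec_space.span (mon ` S)"
    using B(1) H by blast
  then have "finite B"
    using vec_space.independent_span_bound[OF _ B(2)] \<open>finite S\<close> by blast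
  moreover have "vec_space.span B \<subseteq> vec_module.span B"
    by (rule vec_space.span_minimal)
      (auto simp: vec_space.subspace_def vec_module.span_base vec_module.span_zero
        intro: vec_module.span_add vec_module.span_scale)
  ultimately show thesis using B that by blast
qed

lemma lookup_zero_ideal_Var:
  assumes "Poly_Mapping.lookup f 0 = 0"
  shows "f \<in> ideal_generated (range Var)"
proof -
  have "(\<Sum>m\<in>Poly_Mapping.keys f. Poly_Mapping.single m (Poly_Mapping.lookup f m)) \<in> ideal_generated (range Var)"
  proof (rule ideal_sum_mem[OF ideal_ideal_generated])
    fix m assume "m \<in> Poly_Mapping.keys f"
    with assms have "m \<noteq> 0" by (auto simp: in_keys_iff)
    then have "Poly_Mapping.lookup m (some_variable m) > 0" by (rule lookup_some_variable)
    then have "Poly_Mapping.single m (Poly_Mapping.lookup f m) =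
        Poly_Mapping.single (m - Poly_Mapping.single (some_variable m) 1) (Poly_Mapping.lookup f m) * Var (some_variable m)"
      using monomial_minus_add[of m "some_variable m"] by (simp add: Var_def mult_single add.commute)
    also have "\<dots> \<in> ideal_generated (range Var)"
      by (intro ideal_mult ideal_generated_superset) auto
    finally show "Poly_Mapping.single m (Poly_Mapping.lookup f m) \<in> ideal_generated (range Var)" .
  qed
  then show ?thesis by (simp add: poly_mapping_sum_singles)
qed

text \<open>
  Minimality of the presentation comes from choosing as few homogeneous generators as possible: if a
  syzygy had a coefficient with nonzero constant term, its component in the degree of the
  corresponding generator would express this generator by the others.
\<close>

lemma minimal_presentation:
  fixes M :: "(nat \<Rightarrow> ('x::finite, 'k::field) mpoly) set"
  assumes M: "graded_submodule E M" and acyclic: "\<And>t. t > c \<Longrightarrow> koszul_acyclic E M 0 t"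
  obtains D A where "\<forall>d\<in>set D. d \<le> c" "graded_matrix D E A" "\<And>j. j < length D \<Longrightarrow> A j \<in> M"
    "free_hom D E A ` free_module D = M"
    "\<And>v k. v \<in> free_module D \<Longrightarrow> free_hom D E A v = 0 \<Longrightarrow> Poly_Mapping.lookup (v k) 0 = 0"
    "M = {0} \<Longrightarrow> D = []"
proof -
  let ?H = "{v \<in> M. \<exists>t\<le>c. vec_homogeneous E t v}"
  define P where "P = (\<lambda>B. finite B \<and> B \<subseteq> ?H \<and> vec_module.span B = M)"
  have ME: "M \<subseteq> free_module E" using M by (simp add: graded_submodule_def)
  have "\<exists>B. P B"
  proof -
    obtain B where B: "finite B" "B \<subseteq> ?H" "?H \<subseteq> vec_module.span B"
      using finite_low_degree_generators[of ?H E c] ME by blast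
    have "vec_module.span B = M"
    proof
      show "vec_module.span B \<subseteq> M"
        using generated_in_low_degree[OF M acyclic] vec_module.span_mono[OF B(2)] by simp
      show "M \<subseteq> vec_module.span B"
        using generated_in_low_degree[OF M acyclic] vec_module.span_minimal[OF B(3) vec_module.subspace_span] by simp
    qed
    with B show ?thesis by (auto simp: P_def)
  qed
  then obtain B where PB: "P B" and min: "\<And>B'. P B' \<Longrightarrow> card B \<le> card B'"
    using exists_least_iff[of "\<lambda>n. \<exists>B. P B \<and> card B = n"] by (metis linorder_not_less)
  then have B: "finite B" "B \<subseteq> ?H" "vec_module.span B = M" by (auto simp: P_def)
  obtain bs where bs: "set bs = B" "distinct bs"
    using finite_distinct_list[OF B(1)] by blast
  define \<tau> :: "(nat \<Rightarrow> ('x, 'k) mpoly) \<Rightarrow> int" where "\<tau> = (\<lambda>v. SOME t. t \<le> c \<and> vec_homogeneous E t v)"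
  have \<tau>: "\<tau> v \<le> c \<and> vec_homogeneous E (\<tau> v) v" if "v \<in> B" for v
    unfolding \<tau>_def using B(2) that by (intro someI_ex[of "\<lambda>t. t \<le> c \<and> vec_homogeneous E t v"]) auto
  define D where "D = map \<tau> bs"
  define A where "A = (\<lambda>j. bs ! j)"
  have AB: "A j \<in> B" if "j < length D" for j
    using that bs(1) by (auto simp: A_def D_def)
  then have AE: "A j \<in> free_module E" if "j < length D" for j
    using that B(2) ME by blast
  have grad: "graded_matrix D E A"
    using \<tau>[OF AB] by (auto simp: graded_matrix_def vec_homogeneous_def A_def D_def)
  have AD: "A ` {..<length D} = B"
    using bs(1) by (auto simp: A_def D_def set_conv_nth)
  show thesis
  proof (rule that[of D A])
    show "\<forall>d\<in>set D. d \<le> c" using \<tau> bs(1) by (auto simp: D_def)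
    show "A j \<in> M" if "j < length D" for j using AB[OF that] B(2) by blast
    show "free_hom D E A ` free_module D = M"
    proof -
      have "free_hom D E A ` free_module D = vec_module.span (A ` {..<length D})"
        using AE by (rule image_free_hom)
      then show ?thesis by (simp only: AD B(3))
    qed
    show "D = []" if "M = {0}"
    proof -
      have "P {}" using that by (simp add: P_def)
      then have "card B = 0" using min by fastforce
      then show ?thesis using B(1) bs(1) by (simp add: D_def)
    qed
    show "Poly_Mapping.lookup (v j) 0 = 0" if v: "v \<in> free_module D" "free_hom D E A v = 0" for v j
    proof (rule ccontr)
      assume nz: "Poly_Mapping.lookup (v j) 0 \<noteq> 0"
      have "v j = 0" if "\<not> j < length D"
        using v(1) that by (simp add: free_module_def)
      with nz have j: "j < length D" by (metis lookup_zero)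
      define w where "w = vec_comp D (D ! j) v"
      define a where "a = Poly_Mapping.lookup (v j) 0"
      have "vec_homogeneous D (D ! j) w" unfolding w_def by simp
      then have "homogeneous 0 (w j)" using j by (auto simp: vec_homogeneous_def)
      then have "w j = Const (Poly_Mapping.lookup (w j) 0)" by (rule homogeneous_0_eq_Const)
      also have "Poly_Mapping.lookup (w j) 0 = a"
        using j by (simp add: w_def vec_comp_def lookup_hcomp a_def)
      finally have wj: "w j = Const a" .
      have "free_hom D E A w = 0"
        unfolding w_def vec_comp_free_hom[OF grad, symmetric] v(2) by (auto simp: vec_comp_def fun_eq_iff)
      then have "0 = (\<Sum>i<length D. vscale (w i) (A i))"
        using free_hom_eq_sum[of D A E w] AE by simp
      also have "\<dots> = vscale (w j) (A j) + (\<Sum>i\<in>{..<length D} - {j}. vscale (w i) (A i))"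
        using j by (intro sum.remove) auto
      finally have "vscale (w j) (A j) = - (\<Sum>i\<in>{..<length D} - {j}. vscale (w i) (A i))"
        by (simp add: eq_neg_iff_add_eq_0)
      then have "vscale (Const (inverse a)) (vscale (w j) (A j)) =
          vscale (Const (inverse a)) (- (\<Sum>i\<in>{..<length D} - {j}. vscale (w i) (A i)))" by simp
      moreover have "vscale (Const (inverse a)) (vscale (w j) (A j)) = A j"
        using nz unfolding wj vec_module.scale_scale Const_mult[symmetric] by (simp add: a_def)
      moreover have "vscale (Const (inverse a)) (- (\<Sum>i\<in>{..<length D} - {j}. vscale (w i) (A i)))
        \<in> vec_module.span (B - {A j})"
      proof (intro vec_module.span_scale vec_module.span_neg vec_module.span_sum vec_module.span_base)
        fix i assume "i \<in> {..<length D} - {j}"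
        then show "A i \<in> B - {A j}"
          using AB j bs(2) by (auto simp: A_def D_def nth_eq_iff_index_eq)
      qed
      ultimately have "A j \<in> vec_module.span (B - {A j})" by simp
      then have "B \<subseteq> vec_module.span (B - {A j})"
        using vec_module.span_base[of _ "B - {A j}"] by blast
      then have "vec_module.span B \<subseteq> vec_module.span (B - {A j})"
        by (rule vec_module.span_minimal) (rule vec_module.subspace_span)
      moreover have "vec_module.span (B - {A j}) \<subseteq> vec_module.span B"
        by (rule vec_module.span_mono) blast
      ultimately have "P (B - {A j})" using B by (auto simp: P_def)
      then have "card B \<le> card (B - {A j})" by (rule min)
      then show False using card_Diff1_less[OF B(1) AB[OF j]] by simp
    qed
  qed (rule grad)
qed

section \<open>Regularity of ideals of finite colength\<close>

text \<open>
  Why the Koszul complex of \<open>J\<close> is acyclic in degrees \<open>t > d\<close>: a cycle bounds a chain over the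
  polynomial ring whose coefficients have degree \<open>t - 1 \<ge> d\<close>, so this chain already has coefficients
  in \<open>J\<close>. In homological degree above the number of variables there are no chains at all. The invariant
  \<open>Inv n\<close> transports both ranges to the \<open>n\<close>-th syzygy module.
\<close>

lemma regular_ideal_if_contains_degree:
  fixes J :: "('x::finite, 'k::field) mpoly set"
  assumes J: "ideal J" and hc: "\<And>t f. f \<in> J \<Longrightarrow> hcomp t f \<in> J"
    and deg: "\<And>t f. t \<ge> int d \<Longrightarrow> homogeneous t f \<Longrightarrow> f \<in> J"
  shows "regular_ideal (int d) J"
proof -
  let ?n = "CARD('x)"
  \<comment> \<open>The ideal as a submodule of the free module of rank one, so that the augmentation becomes the
    first of the presentations.\<close>
  define M0 :: "(nat \<Rightarrow> ('x, 'k) mpoly) set" where "M0 = {v. v 0 \<in> J \<and> (\<forall>k\<ge>1. v k = 0)}"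
  have M0: "graded_submodule [0] M0"
    using J hc ideal_0[OF J] by (auto simp: graded_submodule_def M0_def free_module_def vec_module.subspace_def
      vec_comp_def ideal_add ideal_mult)
  have acyc0: "koszul_acyclic [0] M0 p t" if "t > int d \<or> p > ?n" for p t
    unfolding koszul_acyclic_def
  proof (intro allI impI)
    fix z assume z: "koszul_chain [0] M0 p t z" and cycle: "koszul_diff z = (\<lambda>_. 0)"
    have zF: "koszul_chain [0] (free_module [0]) p t z"
      using z by (auto simp: koszul_chain_def M0_def free_module_def)
    show "\<exists>w. koszul_chain [0] M0 (Suc p) (t - 1) w \<and> koszul_diff w = z"
    proof (cases "p > ?n")
      case True
      have "card T \<noteq> p" for T :: "'x set"
        using card_mono[of UNIV T] True by fastforce
      then have "z T = 0" for T using z by (auto simp: koszul_chain_def)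
      then have "koszul_chain [0] M0 (Suc p) (t - 1) (\<lambda>_. 0) \<and> koszul_diff (\<lambda>_. 0) = z"
        using ideal_0[OF J] by (auto simp: koszul_chain_def M0_def koszul_diff_def fun_eq_iff)
      then show ?thesis by blast
    next
      case False
      with that have t: "t > int d" by simp
      have z0: "Poly_Mapping.lookup (z {} k) 0 = 0" for k
      proof (cases "k = 0")
        case True
        have "homogeneous t (z {} 0)" using z by (auto simp: koszul_chain_def vec_homogeneous_def)
        with t True show ?thesis by (auto simp: homogeneous_lookup)
      next
        case False
        then show ?thesis using z by (auto simp: koszul_chain_def M0_def)
      qed
      have w: "koszul_chain [0] (free_module [0]) (Suc p) (t - 1) (koszul_homotopy z)"
        by (rule koszul_chain_homotopy[OF zF])
      have "koszul_homotopy z T 0 \<in> J" for T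
        using w t by (intro deg[of "t - 1"]) (auto simp: koszul_chain_def vec_homogeneous_def)
      with w have "koszul_chain [0] M0 (Suc p) (t - 1) (koszul_homotopy z)"
        by (auto simp: koszul_chain_def M0_def free_module_def)
      with koszul_exact[OF cycle z0] show ?thesis by blast
    qed
  qed
  define Inv where "Inv = (\<lambda>n (EM :: int list \<times> (nat \<Rightarrow> ('x, 'k) mpoly) set). graded_submodule (fst EM) (snd EM) \<and>
    (\<forall>p t. t > int d + int n \<or> p + n > ?n \<longrightarrow> koszul_acyclic (fst EM) (snd EM) p t))"
  define Step where "Step = (\<lambda>n (EM :: int list \<times> (nat \<Rightarrow> ('x, 'k) mpoly) set) EM' A.
    (\<forall>d'\<in>set (fst EM'). d' \<le> int d + int n) \<and> graded_matrix (fst EM') (fst EM) A \<and>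
    (\<forall>j<length (fst EM'). A j \<in> snd EM) \<and>
    free_hom (fst EM') (fst EM) A ` free_module (fst EM') = snd EM \<and>
    snd EM' = {v \<in> free_module (fst EM'). free_hom (fst EM') (fst EM) A v = 0} \<and>
    (\<forall>v\<in>snd EM'. \<forall>k. Poly_Mapping.lookup (v k) 0 = 0) \<and>
    (snd EM = {0} \<longrightarrow> fst EM' = []))"
  have "\<exists>f. \<forall>n. Inv n (f n) \<and> (n = 0 \<longrightarrow> f n = ([0], M0)) \<and> (\<exists>A. Step n (f n) (f (Suc n)) A)"
  proof -
    have "\<exists>f. \<forall>n. (Inv n (f n) \<and> (n = 0 \<longrightarrow> f n = ([0], M0))) \<and> (\<exists>A. Step n (f n) (f (Suc n)) A)"
    proof (rule dependent_nat_choice)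
      show "\<exists>x. Inv 0 x \<and> (0 = (0::nat) \<longrightarrow> x = ([0], M0))"
        using M0 acyc0 by (auto simp: Inv_def)
    next
      fix x n assume x: "Inv n x \<and> (n = 0 \<longrightarrow> x = ([0], M0))"
      obtain E M where EM: "x = (E, M)" by (cases x)
      from x have inv: "graded_submodule E M" "\<And>p t. t > int d + int n \<or> p + n > ?n \<Longrightarrow> koszul_acyclic E M p t"
        by (auto simp: Inv_def EM)
      obtain D A where DA: "\<forall>d'\<in>set D. d' \<le> int d + int n" "graded_matrix D E A"
          "\<And>j. j < length D \<Longrightarrow> A j \<in> M" "free_hom D E A ` free_module D = M"
          "\<And>v k. v \<in> free_module D \<Longrightarrow> free_hom D E A v = 0 \<Longrightarrow> Poly_Mapping.lookup (v k) 0 = 0"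
          "M = {0} \<Longrightarrow> D = []"
        using minimal_presentation[OF inv(1), of "int d + int n"] inv(2) by blast
      let ?K = "{v \<in> free_module D. free_hom D E A v = 0}"
      have "Inv (Suc n) (D, ?K)"
        unfolding Inv_def fst_conv snd_conv
      proof (intro conjI allI impI)
        show "graded_submodule D ?K" by (rule graded_submodule_kernel[OF DA(2)])
        fix p t assume "t > int d + int (Suc n) \<or> p + Suc n > ?n"
        then have "koszul_acyclic E M (Suc p) (t - 1)" by (intro inv(2)) auto
        then show "koszul_acyclic D ?K p t" using DA(2,4,5) by (rule koszul_acyclic_syzygies)
      qed
      moreover have "Step n x (D, ?K) A"
        unfolding Step_def EM fst_conv snd_conv using DA by auto
      ultimately show "\<exists>y. (Inv (Suc n) y \<and> (Suc n = 0 \<longrightarrow> y = ([0], M0))) \<and> (\<exists>A. Step n x y A)" by blast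
    qed
    then show ?thesis by auto
  qed
  then obtain f where f: "\<And>n. Inv n (f n)" "f 0 = ([0], M0)" "\<And>n. \<exists>A. Step n (f n) (f (Suc n)) A" by blast
  obtain A where step: "\<And>n. Step n (f n) (f (Suc n)) (A n)"
    using f(3) by metis
  define E :: "nat \<Rightarrow> int list" where "E n = fst (f n)" for n
  define M :: "nat \<Rightarrow> (nat \<Rightarrow> ('x, 'k) mpoly) set" where "M n = snd (f n)" for n
  have E0: "E 0 = [0]" and M0': "M 0 = M0" by (simp_all add: E_def M_def f(2))
  have A: "\<And>n d'. d' \<in> set (E (Suc n)) \<Longrightarrow> d' \<le> int d + int n"
      "\<And>n. graded_matrix (E (Suc n)) (E n) (A n)"
      "\<And>n j. j < length (E (Suc n)) \<Longrightarrow> A n j \<in> M n"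
      "\<And>n. free_hom (E (Suc n)) (E n) (A n) ` free_module (E (Suc n)) = M n"
      "\<And>n. M (Suc n) = {v \<in> free_module (E (Suc n)). free_hom (E (Suc n)) (E n) (A n) v = 0}"
      "\<And>n v k. v \<in> M (Suc n) \<Longrightarrow> Poly_Mapping.lookup (v k) 0 = 0"
      "\<And>n. M n = {0} \<Longrightarrow> E (Suc n) = []"
    using step unfolding Step_def E_def[symmetric] M_def[symmetric] by blast+
  have vanish: "E (Suc n) = []" if "n > ?n" for n
  proof (rule A(7))
    \<comment> \<open>Now generation in degree at most \<open>c\<close> holds for every \<open>c\<close>, even below all basis degrees.\<close>
    define c where "c = Min (insert 0 (set (E n))) - 1"
    have inv: "graded_submodule (E n) (M n)" "\<And>t. koszul_acyclic (E n) (M n) 0 t"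
      using f(1)[of n] that by (auto simp: Inv_def E_def M_def)
    have "{v \<in> M n. \<exists>t\<le>c. vec_homogeneous (E n) t v} \<subseteq> {0}"
    proof clarify
      fix v t assume v: "v \<in> M n" "t \<le> c" "vec_homogeneous (E n) t v"
      have "v k = 0" for k
      proof (cases "k < length (E n)")
        case True
        then have "Min (insert 0 (set (E n))) \<le> E n ! k" by (intro Min_le) auto
        then have "c < E n ! k" by (simp add: c_def)
        with v True show ?thesis
          by (intro homogeneous_neg[of "t - E n ! k"]) (auto simp: vec_homogeneous_def)
      next
        case False
        then show ?thesis using v(1) inv(1) by (auto simp: graded_submodule_def free_module_def)
      qed
      then show "v = 0" by auto
    qed
    then have "vec_module.span {v \<in> M n. \<exists>t\<le>c. vec_homogeneous (E n) t v} \<subseteq> {0}"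
      by (rule vec_module.span_minimal) (simp add: vec_module.subspace_def)
    then show "M n = {0}"
      using generated_in_low_degree[OF inv, of c] inv(1) vec_module.subspace_0[of "M n"]
      by (auto simp: graded_submodule_def)
  qed
  define F where "F = (\<lambda>i. E (Suc i))"
  define e where "e = (\<lambda>j. A 0 j 0)"
  have aug: "free_hom (F 0) (E 0) (A 0) v = (\<lambda>k. if k = 0 then augmentation (F 0) e v else 0)" for v
    by (auto simp: fun_eq_iff free_hom_def augmentation_def e_def E0 F_def)
  have "minimal_free_resolution J F e (\<lambda>i. A (Suc i))"
    unfolding minimal_free_resolution_def
  proof (intro conjI allI impI)
    show "\<exists>l. \<forall>i>l. F i = []" using vanish by (auto simp: F_def)
    show "homogeneous (F 0 ! j) (e j)" if "j < length (F 0)" for j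
      using A(2)[of 0] that by (auto simp: graded_matrix_def E0 F_def e_def)
    show "graded_matrix (F (Suc i)) (F i) (A (Suc i))" for i
      using A(2) by (simp add: F_def)
    show "minimal_matrix (F (Suc i)) (F i) (A (Suc i))" for i
      unfolding minimal_matrix_def F_def
      using A(3)[of _ "Suc i"] A(6) by (blast intro: lookup_zero_ideal_Var)
    show "augmentation (F 0) e ` free_module (F 0) = J"
    proof -
      have "augmentation (F 0) e ` free_module (F 0) = (\<lambda>v. v 0) ` free_hom (F 0) (E 0) (A 0) ` free_module (F 0)"
        by (simp add: aug image_image)
      also have "\<dots> = (\<lambda>v. v 0) ` M0"
        using A(4)[of 0] by (simp add: F_def M0')
      also have "\<dots> = J"
      proof
        show "J \<subseteq> (\<lambda>v. v 0) ` M0"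
          by (intro subsetI image_eqI[of _ _ "\<lambda>k. if k = 0 then _ else 0"]) (auto simp: M0_def)
      qed (auto simp: M0_def)
      finally show ?thesis .
    qed
    have "(\<lambda>k::nat. if k = 0 then x else 0) = 0 \<longleftrightarrow> x = (0 :: ('x, 'k) mpoly)" for x
      by (auto simp: fun_eq_iff)
    then have "M 1 = {v \<in> free_module (F 0). augmentation (F 0) e v = 0}"
      using A(5)[of 0] aug by (simp add: F_def One_nat_def)
    then show "free_hom (F 1) (F 0) (A (Suc 0)) ` free_module (F 1) =
        {v \<in> free_module (F 0). augmentation (F 0) e v = 0}"
      using A(4)[of 1] by (simp add: F_def One_nat_def)
    show "free_hom (F (Suc (Suc i))) (F (Suc i)) (A (Suc (Suc i))) ` free_module (F (Suc (Suc i))) =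
      {v \<in> free_module (F (Suc i)). free_hom (F (Suc i)) (F i) (A (Suc i)) v = (\<lambda>_. 0)}" for i
      using A(4)[of "Suc (Suc i)"] A(5)[of "Suc i"] by (simp add: F_def zero_fun_def)
  qed
  moreover have "\<forall>i. \<forall>d'\<in>set (F i). d' \<le> int d + int i"
    using A(1) by (simp add: F_def)
  ultimately show ?thesis unfolding regular_ideal_def by blast
qed

section \<open>Ideals built from linear ideals\<close>

definition contains_degree :: "nat \<Rightarrow> ('x::finite, 'k::field) mpoly set \<Rightarrow> bool"
  where "contains_degree u I \<longleftrightarrow> (\<forall>t\<ge>int u. \<forall>f. homogeneous t f \<longrightarrow> f \<in> I)"

text \<open>
  The set \<open>D\<close> consists of the degrees allowed for the generators.
\<close>

definition homogeneously_generated :: "int set \<Rightarrow> ('x::finite, 'k::field) mpoly set \<Rightarrow> bool"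
  where "homogeneously_generated D I \<longleftrightarrow> (\<exists>S. (\<forall>f\<in>S. \<exists>d\<in>D. homogeneous d f) \<and> I = ideal_generated S)"

text \<open>
  The linear ideal \<open>K\<close> plays the role of a linear section. The classes are closed under adding linear
  ideals, and the condition has to survive this.
\<close>

definition tame :: "nat \<Rightarrow> ('x::finite, 'k::field) mpoly set \<Rightarrow> bool"
  where "tame u L \<longleftrightarrow> (\<forall>K. linear_ideal K \<longrightarrow> (\<exists>N. contains_degree N (ideal_sum K L)) \<longrightarrow>
    contains_degree u (ideal_sum K L))"

text \<open>
  For \<open>L = 0\<close>, \<open>u = 1\<close> the second condition says that \<open>I\<close> behaves like an \<open>r\<close>-regular ideal with respect to
  its linear sections of finite colength. The additional ideal \<open>L\<close> makes the condition composable, so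
  that \<open>r - 1\<close> is additive under sums of ideals.
\<close>

definition approximately_regular :: "nat \<Rightarrow> ('x::finite, 'k::field) mpoly set \<Rightarrow> bool"
  where "approximately_regular r I \<longleftrightarrow> homogeneously_generated {..int r} I \<and>
    (\<forall>u L. homogeneously_generated UNIV L \<longrightarrow> tame u L \<longrightarrow> tame (u + (r - 1)) (ideal_sum I L))"

lemma ideal_sum_assoc: "ideal_sum (ideal_sum I J) K = ideal_sum I (ideal_sum J K)"
proof (intro equalityI subsetI)
  fix x assume "x \<in> ideal_sum (ideal_sum I J) K"
  then obtain f g h where "x = (f + g) + h" "f \<in> I" "g \<in> J" "h \<in> K"
    by (auto simp: ideal_sum_def)
  then show "x \<in> ideal_sum I (ideal_sum J K)" by (simp add: add.assoc ideal_sumI)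
next
  fix x assume "x \<in> ideal_sum I (ideal_sum J K)"
  then obtain f g h where "x = f + (g + h)" "f \<in> I" "g \<in> J" "h \<in> K"
    by (auto simp: ideal_sum_def)
  then show "x \<in> ideal_sum (ideal_sum I J) K" by (simp add: ideal_sumI flip: add.assoc)
qed

lemma ideal_sum_commute: "ideal_sum I J = ideal_sum J (I :: 'a::comm_ring_1 set)"
  unfolding ideal_sum_def by (metis add.commute)

lemma ideal_sum_left_commute: "ideal_sum I (ideal_sum J K) = ideal_sum J (ideal_sum I (K :: 'a::comm_ring_1 set))"
  by (metis ideal_sum_assoc ideal_sum_commute)

lemma ideal_sum_mono: "I \<subseteq> I' \<Longrightarrow> J \<subseteq> J' \<Longrightarrow> ideal_sum I J \<subseteq> ideal_sum I' J'"
  unfolding ideal_sum_def by blast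

lemma contains_degree_mono: "contains_degree u I \<Longrightarrow> I \<subseteq> J \<Longrightarrow> u \<le> v \<Longrightarrow> contains_degree v J"
  unfolding contains_degree_def by (meson of_nat_mono order_trans subsetD)

lemma homogeneously_generated_ideal: "homogeneously_generated D I \<Longrightarrow> ideal I"
  by (auto simp: homogeneously_generated_def)

lemma homogeneously_generated_mono: "homogeneously_generated D I \<Longrightarrow> D \<subseteq> D' \<Longrightarrow> homogeneously_generated D' I"
  unfolding homogeneously_generated_def by blast

lemma homogeneously_generated_sum:
  assumes "homogeneously_generated D I" "homogeneously_generated D J"
  shows "homogeneously_generated D (ideal_sum I J)"
proof -
  obtain S T where ST: "\<forall>f\<in>S. \<exists>d\<in>D. homogeneous d f" "I = ideal_generated S"
      "\<forall>f\<in>T. \<exists>d\<in>D. homogeneous d f" "J = ideal_generated T"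
    using assms unfolding homogeneously_generated_def by metis
  then have "\<forall>f\<in>S \<union> T. \<exists>d\<in>D. homogeneous d f" by blast
  then show ?thesis
    unfolding homogeneously_generated_def ST(2,4) ideal_sum_eq_generated by blast
qed

lemma linear_ideal_homogeneously_generated: "linear_ideal K \<Longrightarrow> homogeneously_generated {1} K"
  unfolding linear_ideal_def homogeneously_generated_def by blast

lemma linear_ideal_sum:
  assumes "linear_ideal I" "linear_ideal J"
  shows "linear_ideal (ideal_sum I J)"
proof -
  obtain S T where ST: "\<forall>f\<in>S. homogeneous 1 f" "I = ideal_generated S"
      "\<forall>f\<in>T. homogeneous 1 f" "J = ideal_generated T"
    using assms unfolding linear_ideal_def by metis
  then have "\<forall>f\<in>S \<union> T. homogeneous 1 f" by blast
  then show ?thesis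
    unfolding linear_ideal_def ST(2,4) ideal_sum_eq_generated by blast
qed

lemma linear_ideal_ideal: "linear_ideal I \<Longrightarrow> ideal I"
  by (auto simp: linear_ideal_def)

lemma linear_ideal_0: "linear_ideal {0}"
  unfolding linear_ideal_def
  by (rule exI[of _ "{}"]) (simp add: ideal_generated_def module.span_empty[OF module_mult])

lemma homogeneously_generated_hcomp:
  assumes "homogeneously_generated D I" "f \<in> I"
  shows "hcomp t f \<in> I"
proof -
  obtain S where S: "\<forall>f\<in>S. \<exists>d\<in>D. homogeneous d f" "I = ideal_generated S"
    using assms(1) unfolding homogeneously_generated_def by blast
  from assms(2) show ?thesis
    unfolding S(2)
  proof (induction rule: ideal_generated_induct)
    case zero
    show ?case using ideal_0[OF ideal_ideal_generated] by simp
  next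
    case (add a s g)
    with S obtain d where "homogeneous d s" by blast
    then have "hcomp t (a * s + g) = hcomp (t - d) a * s + hcomp t g"
      by (simp add: hcomp_add hcomp_mult)
    with add show ?case
      by (simp add: ideal_add ideal_mult ideal_generated_superset)
  qed
qed

lemma approximately_regular_linear:
  fixes I :: "('x::finite, 'k::field) mpoly set"
  shows "linear_ideal I \<Longrightarrow> approximately_regular 1 I"
  unfolding approximately_regular_def
proof (intro conjI allI impI)
  assume I: "linear_ideal I"
  show "homogeneously_generated {..int 1} I"
    using linear_ideal_homogeneously_generated[OF I] by (rule homogeneously_generated_mono) auto
  fix u :: nat and L :: "('x, 'k) mpoly set" assume L: "tame u L"
  show "tame (u + (1 - 1)) (ideal_sum I L)"
    unfolding tame_def
  proof (intro allI impI)
    fix K :: "('x, 'k) mpoly set" assume K: "linear_ideal K" "\<exists>N. contains_degree N (ideal_sum K (ideal_sum I L))"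
    from L linear_ideal_sum[OF K(1) I] K(2) show "contains_degree (u + (1 - 1)) (ideal_sum K (ideal_sum I L))"
      unfolding tame_def ideal_sum_assoc[symmetric] by simp
  qed
qed

lemma approximately_regular_UNIV: "approximately_regular 1 UNIV"
  unfolding approximately_regular_def
proof (intro conjI allI impI)
  have "UNIV = ideal_generated {1 :: ('a, 'b) mpoly}"
    using ideal_mult[OF ideal_ideal_generated ideal_generated_superset, of 1 "{1}"] by auto
  then show "homogeneously_generated {..int 1} (UNIV :: ('a, 'b) mpoly set)"
    unfolding homogeneously_generated_def
    by (intro exI[of _ "{1 :: ('a, 'b) mpoly}"]) (auto intro!: bexI[of _ 0])
  fix u :: nat and L :: "('a, 'b) mpoly set" assume L: "homogeneously_generated UNIV L"
  show "tame (u + (1 - 1)) (ideal_sum UNIV L)"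
    unfolding tame_def contains_degree_def
  proof (intro allI impI)
    fix K :: "('a, 'b) mpoly set" and f :: "('a, 'b) mpoly" assume "linear_ideal K"
    then show "f \<in> ideal_sum K (ideal_sum UNIV L)"
      using homogeneously_generated_ideal[OF L] by (intro ideal_sumI2[OF linear_ideal_ideal ideal_sumI1]) auto
  qed
qed

lemma approximately_regular_sum:
  fixes A :: "('x::finite, 'k::field) mpoly set"
  assumes A: "approximately_regular a A" and B: "approximately_regular b B" and "a \<ge> 1" "b \<ge> 1"
  shows "approximately_regular (a + b - 1) (ideal_sum A B)"
  unfolding approximately_regular_def
proof (intro conjI allI impI)
  show "homogeneously_generated {..int (a + b - 1)} (ideal_sum A B)"
    using assms unfolding approximately_regular_def
    by (intro homogeneously_generated_sum) (auto elim!: homogeneously_generated_mono)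
  fix u and L :: "('x, 'k) mpoly set" assume L: "homogeneously_generated UNIV L" "tame u L"
  have "tame (u + (b - 1)) (ideal_sum B L)"
    using B L by (auto simp: approximately_regular_def)
  moreover have "homogeneously_generated UNIV (ideal_sum B L)"
    using B L(1) unfolding approximately_regular_def
    by (intro homogeneously_generated_sum) (auto elim!: homogeneously_generated_mono)
  ultimately have "tame (u + (b - 1) + (a - 1)) (ideal_sum A (ideal_sum B L))"
    using A by (auto simp: approximately_regular_def)
  moreover have "u + (b - 1) + (a - 1) = u + (a + b - 1 - 1)" using assms by simp
  ultimately show "tame (u + (a + b - 1 - 1)) (ideal_sum (ideal_sum A B) L)"
    by (simp only: ideal_sum_assoc)
qed

lemma ideal_prod_generated:
  "ideal_prod (ideal_generated S) (ideal_generated T) = ideal_generated {s * t |s t. s \<in> S \<and> t \<in> T}"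
  (is "_ = ideal_generated ?P")
proof
  have "f * g \<in> ideal_generated ?P" if f: "f \<in> ideal_generated S" and g: "g \<in> ideal_generated T" for f g
    using f
  proof (induction rule: ideal_generated_induct)
    case zero
    show ?case using ideal_0[OF ideal_ideal_generated] by simp
  next
    case (add a s f')
    have sg: "s * g \<in> ideal_generated ?P"
      using g
    proof (induction rule: ideal_generated_induct)
      case zero
      show ?case using ideal_0[OF ideal_ideal_generated] by simp
    next
      case (add b t g')
      have st: "s * t \<in> ideal_generated ?P"
        using \<open>s \<in> S\<close> \<open>t \<in> T\<close> by (intro ideal_generated_superset) blast
      have "b * (s * t) + s * g' \<in> ideal_generated ?P"
        by (rule ideal_add[OF ideal_ideal_generated ideal_mult[OF ideal_ideal_generated st] add(2)])
      then show ?case by (simp add: algebra_simps)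
    qed
    have "a * (s * g) + f' * g \<in> ideal_generated ?P"
      by (rule ideal_add[OF ideal_ideal_generated ideal_mult[OF ideal_ideal_generated sg] add(2)])
    then show ?case by (simp add: algebra_simps)
  qed
  then show "ideal_prod (ideal_generated S) (ideal_generated T) \<subseteq> ideal_generated ?P"
    unfolding ideal_prod_def by (intro ideal_generated_minimal) auto
  show "ideal_generated ?P \<subseteq> ideal_prod (ideal_generated S) (ideal_generated T)"
    unfolding ideal_prod_def
    by (intro ideal_generated_minimal ideal_ideal_generated subsetI ideal_generated_superset)
      (auto intro: ideal_generated_superset)
qed

lemma ideal_prodI: "f \<in> I \<Longrightarrow> g \<in> J \<Longrightarrow> f * g \<in> ideal_prod I J"
  unfolding ideal_prod_def by (rule ideal_generated_superset) blast

lemma ideal_prod_subset: "ideal I \<Longrightarrow> ideal J \<Longrightarrow> ideal_prod I J \<subseteq> I \<inter> J"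
  unfolding ideal_prod_def
  by (rule ideal_generated_minimal) (auto intro: ideal_mult ideal_mult_right module.subspace_inter[OF module_mult])

lemma ideal_prod_mono: "I \<subseteq> I' \<Longrightarrow> J \<subseteq> J' \<Longrightarrow> ideal_prod I J \<subseteq> ideal_prod I' J'"
  unfolding ideal_prod_def
  by (intro ideal_generated_minimal ideal_ideal_generated subsetI ideal_generated_superset) blast

lemma homogeneously_generated_prod:
  assumes "homogeneously_generated {..int a} P" "homogeneously_generated {..int b} Q"
  shows "homogeneously_generated {..int (a + b)} (ideal_prod P Q)"
proof -
  obtain S T where ST: "\<forall>f\<in>S. \<exists>d\<in>{..int a}. homogeneous d f" "P = ideal_generated S"
      "\<forall>f\<in>T. \<exists>d\<in>{..int b}. homogeneous d f" "Q = ideal_generated T"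
    using assms unfolding homogeneously_generated_def by metis
  have "\<exists>d\<in>{..int (a + b)}. homogeneous d (s * t)" if "s \<in> S" "t \<in> T" for s t
  proof -
    obtain d e where "d \<le> int a" "homogeneous d s" "e \<le> int b" "homogeneous e t"
      using bspec[OF ST(1) \<open>s \<in> S\<close>] bspec[OF ST(3) \<open>t \<in> T\<close>] by auto
    then show ?thesis by (intro bexI[of _ "d + e"] homogeneous_mult) auto
  qed
  then have "\<forall>f\<in>{s * t |s t. s \<in> S \<and> t \<in> T}. \<exists>d\<in>{..int (a + b)}. homogeneous d f"
    by blast
  then show ?thesis
    unfolding ST(2,4) ideal_prod_generated homogeneously_generated_def by blast
qed

text \<open>
  Let \<open>H = K + L\<close>. By hypothesis \<open>P + H\<close> contains \<open>\<mm>^(u + p - 1)\<close> and \<open>Q + H\<close> contains \<open>\<mm>^(u + q - 1)\<close>. Multiplying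
  these inclusions would give the exponent \<open>2 u + p + q - 2\<close>, which is too weak. Instead a form of degree
  \<open>u + p + q - 1\<close> is first written, modulo \<open>H\<close>, as an element of \<open>Q\<close>. As \<open>Q\<close> is generated in degree at most
  \<open>q\<close>, the coefficients of the generators have degree at least \<open>u + p - 1\<close> and so lie in \<open>P + H\<close>.
\<close>

lemma approximately_regular_prod:
  fixes P :: "('x::finite, 'k::field) mpoly set"
  assumes P: "approximately_regular p P" and Q: "approximately_regular q Q" and "p \<ge> 1" "q \<ge> 1"
  shows "approximately_regular (p + q) (ideal_prod P Q)"
  unfolding approximately_regular_def
proof (intro conjI allI impI)
  have gP: "homogeneously_generated {..int p} P" and gQ: "homogeneously_generated {..int q} Q"
    using P Q by (auto simp: approximately_regular_def)
  note iP = homogeneously_generated_ideal[OF gP] and iQ = homogeneously_generated_ideal[OF gQ]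
  show gPQ: "homogeneously_generated {..int (p + q)} (ideal_prod P Q)"
    by (rule homogeneously_generated_prod[OF gP gQ])
  fix u and L :: "('x, 'k) mpoly set" assume L: "homogeneously_generated UNIV L" "tame u L"
  show "tame (u + (p + q - 1)) (ideal_sum (ideal_prod P Q) L)"
    unfolding tame_def
  proof (intro allI impI)
    fix K :: "('x, 'k) mpoly set" assume K: "linear_ideal K" "\<exists>N. contains_degree N (ideal_sum K (ideal_sum (ideal_prod P Q) L))"
    define H where "H = ideal_sum K L"
    define X where "X = ideal_sum (ideal_prod P Q) H"
    have gH: "homogeneously_generated UNIV H"
      unfolding H_def using linear_ideal_homogeneously_generated[OF K(1)] L(1)
      by (intro homogeneously_generated_sum) (auto elim!: homogeneously_generated_mono)
    have gX: "homogeneously_generated UNIV X"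
      unfolding X_def using gH gPQ
      by (intro homogeneously_generated_sum) (auto elim!: homogeneously_generated_mono)
    note iH = homogeneously_generated_ideal[OF gH] and iX = homogeneously_generated_ideal[OF gX]
    have X: "ideal_sum K (ideal_sum (ideal_prod P Q) L) = X"
      unfolding X_def H_def by (rule ideal_sum_left_commute)
    have cP: "contains_degree (u + (p - 1)) (ideal_sum P H)"
    proof -
      have "tame (u + (p - 1)) (ideal_sum P L)" using P L by (auto simp: approximately_regular_def)
      moreover have "X \<subseteq> ideal_sum K (ideal_sum P L)"
        unfolding ideal_sum_left_commute[of K P L] X_def H_def using ideal_prod_subset[OF iP iQ]
        by (intro ideal_sum_mono) auto
      ultimately show ?thesis
        using K contains_degree_mono unfolding tame_def X H_def ideal_sum_left_commute[of P K L] by blast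
    qed
    have cQ: "contains_degree (u + (q - 1)) (ideal_sum Q H)"
    proof -
      have "tame (u + (q - 1)) (ideal_sum Q L)" using Q L by (auto simp: approximately_regular_def)
      moreover have "X \<subseteq> ideal_sum K (ideal_sum Q L)"
        unfolding ideal_sum_left_commute[of K Q L] X_def H_def using ideal_prod_subset[OF iP iQ]
        by (intro ideal_sum_mono) auto
      ultimately show ?thesis
        using K contains_degree_mono unfolding tame_def X H_def ideal_sum_left_commute[of Q K L] by blast
    qed
    have HX: "H \<subseteq> X" unfolding X_def using homogeneously_generated_ideal[OF gPQ] by (auto intro: ideal_sumI2)
    have PQX: "ideal_prod P Q \<subseteq> X" unfolding X_def using iH by (auto intro: ideal_sumI1)
    show "contains_degree (u + (p + q - 1)) (ideal_sum K (ideal_sum (ideal_prod P Q) L))"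
      unfolding X contains_degree_def
    proof (intro allI impI)
      fix t and f :: "('x, 'k) mpoly" assume t: "int (u + (p + q - 1)) \<le> t" and f: "homogeneous t f"
      obtain S where S: "\<forall>f\<in>S. \<exists>d\<in>{..int q}. homogeneous d f" "Q = ideal_generated S"
        using gQ unfolding homogeneously_generated_def by blast
      have Qt: "hcomp t g \<in> X" if "g \<in> Q" for g
        using that unfolding S(2)
      proof (induction rule: ideal_generated_induct)
        case zero
        show ?case using ideal_0[OF iX] by simp
      next
        case (add a s g')
        obtain d where d: "d \<le> int q" "homogeneous d s" using S(1) add(1) by blast
        have "hcomp (t - d) a \<in> ideal_sum P H"
        proof -
          have "int (u + (p - 1)) \<le> t - d"
            using t d(1) assms(3,4) by (simp add: of_nat_diff)
          then show ?thesis using cP homogeneous_hcomp unfolding contains_degree_def by blast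
        qed
        then obtain x h where xh: "hcomp (t - d) a = x + h" "x \<in> P" "h \<in> H"
          unfolding ideal_sum_def by blast
        have "s \<in> Q" unfolding S(2) using add(1) by (rule ideal_generated_superset)
        then have "x * s \<in> X" using PQX xh(2) ideal_prodI by blast
        moreover have "h * s \<in> X" using HX xh(3) ideal_mult_right[OF iH] by blast
        ultimately have "hcomp (t - d) a * s + hcomp t g' \<in> X"
          unfolding xh(1) distrib_right using add(2) by (intro ideal_add iX)
        then show ?case using d(2) by (simp add: hcomp_add hcomp_mult)
      qed
      have "f \<in> ideal_sum Q H"
      proof -
        have "int (u + (q - 1)) \<le> t" using t assms(3,4) by simp
        then show ?thesis using cQ f unfolding contains_degree_def by blast
      qed
      then obtain g h where gh: "f = g + h" "g \<in> Q" "h \<in> H"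
        unfolding ideal_sum_def by blast
      have "f = hcomp t f" using hcomp_homogeneous[OF f, of t] by simp
      also have "\<dots> = hcomp t g + hcomp t h" by (simp add: gh(1) hcomp_add)
      also have "\<dots> \<in> X"
        using Qt[OF gh(2)] HX homogeneously_generated_hcomp[OF gH gh(3)] by (intro ideal_add iX) auto
      finally show "f \<in> X" .
    qed
  qed
qed

subsection \<open>Linear ideals of finite colength\<close>

lemma linear_form_eq:
  fixes f :: "('x::finite, 'k::field) mpoly"
  assumes "homogeneous 1 f"
  shows "f = (\<Sum>x\<in>UNIV. Const (Poly_Mapping.lookup f (Poly_Mapping.single x 1)) * Var x)"
proof (rule poly_mapping_eqI)
  fix m :: "'x \<Rightarrow>\<^sub>0 nat"
  have rhs: "Poly_Mapping.lookup (\<Sum>x\<in>UNIV. Const (Poly_Mapping.lookup f (Poly_Mapping.single x 1)) * Var x) m =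
    (\<Sum>x\<in>UNIV. if m = Poly_Mapping.single x 1 then Poly_Mapping.lookup f m else 0)"
    unfolding lookup_sum by (intro sum.cong) (auto simp: Var_def lookup_single when_def)
  show "Poly_Mapping.lookup f m = Poly_Mapping.lookup (\<Sum>x\<in>UNIV. Const (Poly_Mapping.lookup f (Poly_Mapping.single x 1)) * Var x) m"
  proof (cases "mdeg m = 1")
    case True
    then have "m \<noteq> 0" by auto
    define x where "x = some_variable m"
    have "Poly_Mapping.lookup m x > 0"
      unfolding x_def by (rule lookup_some_variable) fact
    then have eq: "Poly_Mapping.single x 1 + (m - Poly_Mapping.single x 1) = m"
      by (rule monomial_minus_add)
    have "mdeg (m - Poly_Mapping.single x 1) = 0"
      using arg_cong[OF eq, of mdeg] True by (simp add: mdeg_add)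
    with eq have m: "m = Poly_Mapping.single x 1" by simp
    have "(m = Poly_Mapping.single y 1) \<longleftrightarrow> y = x" for y
      unfolding m by (metis lookup_single_eq lookup_single_not_eq zero_neq_one)
    then show ?thesis unfolding rhs by simp
  next
    case False
    then have "m \<noteq> Poly_Mapping.single x 1" for x by auto
    then show ?thesis unfolding rhs using False assms by (auto simp: homogeneous_lookup)
  qed
qed

text \<open>
  If the variable were not a combination of the linear forms generating \<open>K\<close>, some linear functional on
  the space of linear forms, that is, some point, would annihilate these forms and take the value \<open>1\<close>
  at the variable, hence also at all its powers.
\<close>

lemma Var_in_linear_ideal:
  fixes K :: "('x::finite, 'k::field) mpoly set"
  assumes K: "linear_ideal K" and power: "Var x ^ N \<in> K"
  shows "Var x \<in> K"
proof (rule ccontr)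
  assume notin: "Var x \<notin> K"
  obtain L where L: "\<forall>f\<in>L. homogeneous 1 f" "K = ideal_generated L"
    using K unfolding linear_ideal_def by blast
  note iK = linear_ideal_ideal[OF K]
  define form :: "'k ^ 'x \<Rightarrow> ('x, 'k) mpoly" where "form = (\<lambda>w. \<Sum>y\<in>UNIV. Const (w $ y) * Var y)"
  define cf :: "('x, 'k) mpoly \<Rightarrow> 'k ^ 'x" where "cf = (\<lambda>f. \<chi> y. Poly_Mapping.lookup f (Poly_Mapping.single y 1))"
  have form_cf: "form (cf f) = f" if "homogeneous 1 f" for f
    using linear_form_eq[OF that] by (simp add: form_def cf_def)
  have "vec.subspace {w. form w \<in> K}"
  proof (rule vec.subspaceI)
    show "0 \<in> {w. form w \<in> K}" using ideal_0[OF iK] by (simp add: form_def)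
    show "a + b \<in> {w. form w \<in> K}" if "a \<in> {w. form w \<in> K}" "b \<in> {w. form w \<in> K}" for a b
      using ideal_add[OF iK, of "form a" "form b"] that
      by (simp add: form_def Const_add sum.distrib distrib_right)
    show "c *s a \<in> {w. form w \<in> K}" if "a \<in> {w. form w \<in> K}" for c a
      using ideal_mult[OF iK, of "form a" "Const c"] that
      by (simp add: form_def Const_mult sum_distrib_left mult.assoc)
  qed
  moreover have "cf ` L \<subseteq> {w. form w \<in> K}"
    using L by (auto simp: form_cf ideal_generated_superset)
  ultimately have span: "vec.span (cf ` L) \<subseteq> {w. form w \<in> K}"
    by (intro vec.span_minimal)
  have "form (axis x 1) = (\<Sum>y\<in>UNIV. if y = x then Var x else 0)"
    unfolding form_def by (intro sum.cong) (auto simp: axis_def)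
  then have "form (axis x 1) = Var x" by simp
  with span notin have x_notin: "axis x 1 \<notin> vec.span (cf ` L)" by auto
  obtain B where B: "B \<subseteq> vec.span (cf ` L)" "vec.independent B" "vec.span (cf ` L) \<subseteq> vec.span B"
    using vec.maximal_independent_subset[of "vec.span (cf ` L)"] by blast
  have "vec.span B \<subseteq> vec.span (cf ` L)"
    using B(1) by (intro vec.span_minimal vec.subspace_span)
  with x_notin have x_B: "axis x 1 \<notin> vec.span B" by blast
  then have "vec.independent (insert (axis x 1) B)"
    using B(2) by (rule vec.independent_insertI)
  then obtain g :: "'k ^ 'x \<Rightarrow> 'k ^ 'x" where g: "Vector_Spaces.linear (*s) (*s) g"
      "\<forall>w\<in>insert (axis x 1) B. g w = (if w = axis x 1 then axis x 1 else 0)"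
    using vec.linear_independent_extend[of _ "\<lambda>w. if w = axis x 1 then axis x 1 else 0"] by blast
  interpret g: Vector_Spaces.linear "(*s)" "(*s)" g by fact
  have "axis x 1 \<notin> B" using x_B vec.span_base by blast
  then have "B \<subseteq> {w. g w = 0}" using g(2) by auto
  then have gB: "g w = 0" if "w \<in> vec.span B" for w
    using vec.span_minimal[of B "{w. g w = 0}"] that g.subspace_kernel by blast
  define v where "v = (\<lambda>y. g (axis y 1) $ x)"
  have eval: "eval_at v (form w) = g w $ x" for w
  proof -
    have "w = (\<Sum>y\<in>UNIV. w $ y *s axis y 1)"
      by (simp add: vec_eq_iff axis_def if_distrib[of "\<lambda>a. _ * a"] cong: if_cong)
    then have "g w = (\<Sum>y\<in>UNIV. w $ y *s g (axis y 1))"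
      by (metis (no_types, lifting) g.scale g.sum sum.cong)
    then show ?thesis
      by (simp add: form_def id_def eval_at_simps v_def)
  qed
  have "eval_at v f = 0" if "f \<in> K" for f
    using that unfolding L(2)
  proof (induction rule: ideal_generated_induct)
    case zero
    show ?case by (simp add: id_def eval_at_simps)
  next
    case (add a s h)
    have "cf s \<in> vec.span B" using add(1) B(3) vec.span_base[of "cf s" "cf ` L"] by blast
    then have "eval_at v s = 0"
      using eval[of "cf s"] gB form_cf add(1) L(1) by simp
    with add(2) show ?case by (simp add: id_def eval_at_simps)
  qed
  with power have "eval_at v (Var x ^ N) = 0" by blast
  moreover have "v x = 1" using g(2) by (simp add: v_def axis_def)
  ultimately show False by (simp add: id_def eval_at_simps)
qed

lemma tame_0: "tame 1 {0}"
  unfolding tame_def ideal_sum_0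
proof (intro allI impI)
  fix K :: "('x::finite, 'k::field) mpoly set" assume K: "linear_ideal K" "\<exists>N. contains_degree N K"
  then obtain N where N: "contains_degree N K" by blast
  have "Var x \<in> K" for x
  proof (rule Var_in_linear_ideal[OF K(1)])
    have "homogeneous (int N) (Var x ^ N :: ('x, 'k) mpoly)"
      using homogeneous_power[OF homogeneous_Var, of N x] by simp
    with N show "Var x ^ N \<in> K" unfolding contains_degree_def by blast
  qed
  then have "ideal_generated (range Var) \<subseteq> K"
    by (intro ideal_generated_minimal linear_ideal_ideal[OF K(1)]) auto
  moreover have "f \<in> ideal_generated (range Var)" if "int 1 \<le> t" "homogeneous t f" for t f
    using that by (intro lookup_zero_ideal_Var) (auto simp: homogeneous_lookup)
  ultimately show "contains_degree 1 K" unfolding contains_degree_def by blast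
qed

text \<open>
  Pigeonhole principle: a monomial of degree at least the sum of the exponents is divisible by one of
  the powers.
\<close>

lemma contains_degree_if_powers:
  fixes I :: "('x::finite, 'k::field) mpoly set"
  assumes I: "ideal I" and powers: "\<And>x. \<exists>N. Var x ^ N \<in> I"
  shows "\<exists>N. contains_degree N I"
proof -
  obtain N where N: "\<And>x. Var x ^ N x \<in> I" using powers by metis
  have mono: "Poly_Mapping.single m c \<in> I" if "(\<Sum>x\<in>UNIV. N x) \<le> mdeg m" for m c
  proof -
    have "\<exists>x. N x \<le> Poly_Mapping.lookup m x"
    proof (rule ccontr)
      assume "\<not> ?thesis"
      then have "mdeg m < (\<Sum>x\<in>UNIV. N x)"
        unfolding mdeg_def by (intro sum_strict_mono) (auto simp: not_le)
      with that show False by simp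
    qed
    then obtain x where x: "N x \<le> Poly_Mapping.lookup m x" ..
    have "m - Poly_Mapping.single x (N x) + Poly_Mapping.single x (N x) = m"
      using x by (intro poly_mapping_eqI) (auto simp: lookup_add lookup_minus lookup_single when_def)
    then have "Poly_Mapping.single m c = Poly_Mapping.single (m - Poly_Mapping.single x (N x)) c * Var x ^ N x"
      by (simp add: power_Var mult_single)
    then show ?thesis using N ideal_mult[OF I] by simp
  qed
  have "contains_degree (\<Sum>x\<in>UNIV. N x) I"
    unfolding contains_degree_def
  proof (intro allI impI)
    fix t and f :: "('x, 'k) mpoly" assume t: "int (\<Sum>x\<in>UNIV. N x) \<le> t" "homogeneous t f"
    have "(\<Sum>m\<in>Poly_Mapping.keys f. Poly_Mapping.single m (Poly_Mapping.lookup f m)) \<in> I"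
    proof (rule ideal_sum_mem[OF I mono])
      fix m assume "m \<in> Poly_Mapping.keys f"
      with t have "int (\<Sum>x\<in>UNIV. N x) \<le> int (mdeg m)" by (auto simp: homogeneous_def)
      then show "(\<Sum>x\<in>UNIV. N x) \<le> mdeg m" by linarith
    qed
    then show "f \<in> I" by (simp add: poly_mapping_sum_singles)
  qed
  then show ?thesis by blast
qed

subsection \<open>Replacing intersections by products\<close>

lemma power_add_decompose:
  fixes f g :: "'a::comm_ring_1"
  shows "\<exists>q. (f + g) ^ n = f ^ n + g * q"
proof (induction n)
  case 0
  show ?case by (rule exI[of _ 0]) simp
next
  case (Suc n)
  then obtain q where "(f + g) ^ n = f ^ n + g * q" ..
  then have "(f + g) ^ Suc n = f ^ Suc n + g * (f ^ n + f * q + g * q)"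
    by (simp add: algebra_simps)
  then show ?case ..
qed

lemma power_in_ideal_sum:
  assumes "ideal I" "ideal J" "f ^ m \<in> I" "g ^ n \<in> J"
  shows "(f + g) ^ (m * n) \<in> ideal_sum I J"
proof -
  obtain q where q: "(f + g) ^ m = f ^ m + g * q" using power_add_decompose by blast
  obtain q' where q': "(g * q + f ^ m) ^ n = (g * q) ^ n + f ^ m * q'" using power_add_decompose by blast
  have "(f + g) ^ (m * n) = f ^ m * q' + g ^ n * q ^ n"
    using q' by (simp add: power_mult q add.commute power_mult_distrib)
  then show ?thesis using assms by (simp add: ideal_sumI ideal_mult_right)
qed

text \<open>
  The ideal \<open>I'\<close> approximates \<open>I\<close> from below and has the same radical. Passing to it does not change
  whether a linear section has finite colength.
\<close>

definition approximable :: "nat \<Rightarrow> ('x::finite, 'k::field) mpoly set \<Rightarrow> bool"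
  where "approximable r I \<longleftrightarrow> ideal I \<and>
    (\<exists>I'. I' \<subseteq> I \<and> (\<forall>f\<in>I. \<exists>n. f ^ n \<in> I') \<and> approximately_regular r I')"

lemma approximately_regular_ideal: "approximately_regular r I \<Longrightarrow> ideal I"
  unfolding approximately_regular_def by (auto intro: homogeneously_generated_ideal)

lemma approximable_self: "approximately_regular r I \<Longrightarrow> approximable r I"
  unfolding approximable_def
  by (intro conjI exI[of _ I] ballI exI[of _ 1]) (auto intro: approximately_regular_ideal)

lemma approximable_sum:
  assumes "approximable a I" "approximable b J" "a \<ge> 1" "b \<ge> 1"
  shows "approximable (a + b - 1) (ideal_sum I J)"
proof -
  obtain I' J' where IJ: "I' \<subseteq> I" "\<forall>f\<in>I. \<exists>n. f ^ n \<in> I'" "approximately_regular a I'"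
      "J' \<subseteq> J" "\<forall>f\<in>J. \<exists>n. f ^ n \<in> J'" "approximately_regular b J'"
    using assms(1,2) unfolding approximable_def by blast
  have "\<exists>n. f ^ n \<in> ideal_sum I' J'" if f: "f \<in> ideal_sum I J" for f
  proof -
    obtain g h where gh: "f = g + h" "g \<in> I" "h \<in> J" using f unfolding ideal_sum_def by blast
    obtain m n where "g ^ m \<in> I'" "h ^ n \<in> J'" using IJ(2,5) gh(2,3) by blast
    then show ?thesis
      unfolding gh(1) using IJ(3,6) by (blast intro: power_in_ideal_sum approximately_regular_ideal)
  qed
  moreover have "approximately_regular (a + b - 1) (ideal_sum I' J')"
    by (rule approximately_regular_sum[OF IJ(3,6) assms(3,4)])
  moreover have "ideal (ideal_sum I J)"
    using assms(1,2) unfolding approximable_def by (intro ideal_ideal_sum) auto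
  ultimately show ?thesis
    unfolding approximable_def using ideal_sum_mono[OF IJ(1,4)] by blast
qed

text \<open>
  Applied to the product and to the intersection of \<open>I\<close> and \<open>J\<close>, which have the same radical. In both
  cases the approximation is a product, whose generators have bounded degree; for an
  intersection such a bound is not available directly.
\<close>

lemma approximable_between:
  assumes "approximable a I" "approximable b J" "a \<ge> 1" "b \<ge> 1"
    and H: "ideal H" "ideal_prod I J \<subseteq> H" "H \<subseteq> I \<inter> J"
  shows "approximable (a + b) H"
proof -
  obtain I' J' where IJ: "I' \<subseteq> I" "\<forall>f\<in>I. \<exists>n. f ^ n \<in> I'" "approximately_regular a I'"
      "J' \<subseteq> J" "\<forall>f\<in>J. \<exists>n. f ^ n \<in> J'" "approximately_regular b J'"
    using assms(1,2) unfolding approximable_def by blast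
  have "\<exists>n. f ^ n \<in> ideal_prod I' J'" if f: "f \<in> H" for f
  proof -
    obtain m n where "f ^ m \<in> I'" "f ^ n \<in> J'" using IJ(2,5) f H(3) by blast
    then have "f ^ (m + n) \<in> ideal_prod I' J'" unfolding power_add by (rule ideal_prodI)
    then show ?thesis ..
  qed
  moreover have "approximately_regular (a + b) (ideal_prod I' J')"
    by (rule approximately_regular_prod[OF IJ(3,6) assms(3,4)])
  moreover have "ideal_prod I' J' \<subseteq> H"
    using ideal_prod_mono[OF IJ(1,4)] H(2) by blast
  ultimately show ?thesis
    unfolding approximable_def using H(1) by blast
qed

text \<open>
  The maximum accounts for the zero ideal, which lies in \<open>\<C>\<^sub>0\<close> but has to be treated as a linear ideal.
\<close>

lemma in_class_approximable: "in_class r I \<Longrightarrow> approximable (max r 1) I"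
proof (induction rule: in_class.induct)
  case zero_0
  show ?case using approximable_self[OF approximately_regular_linear[OF linear_ideal_0]] by simp
next
  case unit_0
  show ?case using approximable_self[OF approximately_regular_UNIV] by simp
next
  case (class_0_1 I)
  then show ?case by simp
next
  case (linear_1 I)
  then show ?case using approximable_self[OF approximately_regular_linear] by simp
next
  case (inter a I b J K r)
  then have IJ: "approximable a I" "approximable b J" "approximable 1 K" by (simp_all add: max_def)
  have ab: "a \<ge> 1" "b \<ge> 1" using inter by auto
  have i: "ideal I" "ideal J" using IJ by (auto simp: approximable_def)
  have "approximable (a + b) (I \<inter> J)"
    using i by (intro approximable_between[OF IJ(1,2) ab] module.subspace_inter[OF module_mult]
        ideal_prod_subset) auto
  then have "approximable (a + b + 1 - 1) (ideal_sum (I \<inter> J) K)"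
    using inter by (intro approximable_sum IJ(3)) auto
  with inter show ?case by (simp add: max_def)
next
  case (prod a I b J K r)
  then have IJ: "approximable a I" "approximable b J" "approximable 1 K" by (simp_all add: max_def)
  have ab: "a \<ge> 1" "b \<ge> 1" using prod by auto
  have i: "ideal I" "ideal J" using IJ by (auto simp: approximable_def)
  have "approximable (a + b) (ideal_prod I J)"
    by (rule approximable_between[OF IJ(1,2) ab _ subset_refl ideal_prod_subset[OF i]])
      (simp add: ideal_prod_def)
  then have "approximable (a + b + 1 - 1) (ideal_sum (ideal_prod I J) K)"
    using prod by (intro approximable_sum IJ(3)) auto
  with prod show ?case by (simp add: max_def)
next
  case (sum a I b J r)
  then have "approximable a I" "approximable b J" by (simp_all add: max_def)
  then have "approximable (a + b - 1) (ideal_sum I J)" using sum by (intro approximable_sum) auto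
  moreover have "max r 1 = a + b - 1" using sum by auto
  ultimately show ?case by simp
qed

lemma in_class_contains_degree:
  assumes I: "in_class r I" and r: "r \<ge> 1" and K: "linear_ideal K"
    and powers: "\<And>x. \<exists>N. Var x ^ N \<in> ideal_sum I K"
  shows "contains_degree r (ideal_sum I K)"
proof -
  obtain I' where I': "I' \<subseteq> I" "\<forall>f\<in>I. \<exists>n. f ^ n \<in> I'" "approximately_regular r I'"
    using in_class_approximable[OF I] r unfolding approximable_def by (auto simp: max_def)
  note iI' = approximately_regular_ideal[OF I'(3)] and iK = linear_ideal_ideal[OF K]
  have "\<exists>N. Var x ^ N \<in> ideal_sum I' K" for x
  proof -
    obtain N f g where f: "Var x ^ N = f + g" "f \<in> I" "g \<in> K"
      using powers[of x] unfolding ideal_sum_def by blast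
    obtain n where n: "f ^ n \<in> I'" using I'(2) f(2) by blast
    have "(f + g) ^ (n * 1) \<in> ideal_sum I' K"
      using f(3) by (intro power_in_ideal_sum iI' iK n) simp
    then show ?thesis unfolding f(1)[symmetric] power_mult[symmetric] by blast
  qed
  then have "\<exists>N. contains_degree N (ideal_sum I' K)"
    by (intro contains_degree_if_powers ideal_ideal_sum iI' iK)
  moreover have "tame (1 + (r - 1)) (ideal_sum I' {0})"
    using I'(3) tame_0 homogeneously_generated_mono[OF linear_ideal_homogeneously_generated[OF linear_ideal_0]]
    unfolding approximately_regular_def by blast
  ultimately have "contains_degree r (ideal_sum K I')"
    using K r by (simp add: tame_def ideal_sum_commute[of I' K])
  then show ?thesis
    unfolding ideal_sum_commute[of K I'] using ideal_sum_mono[OF I'(1) subset_refl] contains_degree_mono by blast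
qed

section \<open>Invariants and the Reynolds operator\<close>

locale nonmodular_representation =
  fixes G :: "('g, 'b) monoid_scheme" (structure)
    and \<phi> :: "'g \<Rightarrow> 'k::field ^ 'n::finite \<Rightarrow> 'k ^ 'n"
  assumes infinite_field: "infinite (UNIV :: 'k set)"
    and group: "group G" and finite_carrier: "finite (carrier G)"
    and nonmodular: "\<not> CHAR('k) dvd order G"
    and rep: "representation G \<phi>"

sublocale nonmodular_representation \<subseteq> group G
  by (rule group)

context nonmodular_representation
begin

lemma \<phi>_linear: "g \<in> carrier G \<Longrightarrow> Vector_Spaces.linear (*s) (*s) (\<phi> g)"
  using rep by (simp add: representation_def)

lemma \<phi>_mult: "g \<in> carrier G \<Longrightarrow> h \<in> carrier G \<Longrightarrow> \<phi> (g \<otimes> h) v = \<phi> g (\<phi> h v)"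
  using rep group_action.composition_rule[of G UNIV \<phi> v g h] by (simp add: representation_def)

lemma \<phi>_one: "\<phi> \<one> v = v"
proof -
  have "group_action G UNIV \<phi>" using rep by (simp add: representation_def)
  from fun_cong[OF group_action.id_eq_one[OF this], of v] show ?thesis by simp
qed

lemma \<phi>_inv: "g \<in> carrier G \<Longrightarrow> \<phi> (inv g) (\<phi> g v) = v"
  using \<phi>_mult[of "inv g" g v] by (simp add: \<phi>_one)

lemma matrix_\<phi>: "g \<in> carrier G \<Longrightarrow> (\<Sum>j\<in>UNIV. matrix (\<phi> g) $ i $ j * v $ j) = \<phi> g v $ i"
  using matrix_works[OF \<phi>_linear, of g v] by (simp add: matrix_vector_mult_def vec_eq_iff)

lemma mpoly_eqI:
  fixes f h :: "('n, 'k) mpoly"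
  assumes "\<And>v :: 'k ^ 'n. eval_at (($) v) f = eval_at (($) v) h"
  shows "f = h"
proof -
  have "eval_at v (f - h) = 0" for v
    using assms[of "vec_lambda v"] by (simp only: eval_at.evaluate_diff vec_lambda_inverse[OF UNIV_I]) simp
  then have "f - h = 0" by (rule mpoly_eq_0_if_vanishing[OF infinite_field])
  then show ?thesis by simp
qed

lemma eval_act:
  assumes "g \<in> carrier G"
  shows "eval_at (($) v) (act G \<phi> g f) = eval_at (($) (\<phi> (inv g) v)) f"
proof -
  have "eval_at (($) v) (\<Sum>j\<in>UNIV. Const (matrix (\<phi> (inv g)) $ i $ j) * Var j) = \<phi> (inv g) v $ i" for i
    using matrix_\<phi>[of "inv g" i v] assms by (simp add: id_def eval_at_simps)
  then show ?thesis unfolding act_def eval_at_substitute by simp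
qed

text \<open>
  Over an infinite field, identities between polynomials may be checked on points; this avoids computing
  with the matrices of the representation.
\<close>

lemma act_act:
  assumes "g \<in> carrier G" "h \<in> carrier G"
  shows "act G \<phi> g (act G \<phi> h f) = act G \<phi> (g \<otimes> h) f"
  by (rule mpoly_eqI) (use assms in \<open>simp only: eval_act m_closed inv_mult_group \<phi>_mult inv_closed\<close>)

lemma act_1 [simp]: "act G \<phi> g 1 = 1" and act_add: "act G \<phi> g (f + h) = act G \<phi> g f + act G \<phi> g h"
  and act_mult: "act G \<phi> g (f * h) = act G \<phi> g f * act G \<phi> g h" and act_0 [simp]: "act G \<phi> g 0 = 0"
  and act_Const [simp]: "act G \<phi> g (Const c) = Const c" and act_power: "act G \<phi> g (f ^ n) = act G \<phi> g f ^ n"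
  and act_sum: "act G \<phi> g (sum F A) = (\<Sum>a\<in>A. act G \<phi> g (F a))"
  and act_prod: "act G \<phi> g (prod F A) = (\<Prod>a\<in>A. act G \<phi> g (F a))"
  by (simp_all only: act_def substitute.evaluate_simps)

lemma homogeneous_act: "homogeneous d f \<Longrightarrow> homogeneous d (act G \<phi> g f)"
  unfolding act_def
  by (rule homogeneous_substitute) (auto intro!: homogeneous_sum homogeneous_Const_mult)

lemma hcomp_act: "hcomp t (act G \<phi> g f) = act G \<phi> g (hcomp t f)"
proof (induction f rule: poly_mapping_single_induct)
  case (single m c)
  show ?case
    using hcomp_homogeneous[OF homogeneous_single[of m c], of t]
      hcomp_homogeneous[OF homogeneous_act[OF homogeneous_single[of m c]], of t] by simp
qed (simp_all add: hcomp_add act_add)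

abbreviation invariants :: "('n, 'k) mpoly set"
  where "invariants \<equiv> invariant_ring G \<phi>"

lemma invariant_hcomp: "f \<in> invariants \<Longrightarrow> hcomp t f \<in> invariants"
  by (simp add: invariant_ring_def hcomp_act[symmetric])

lemma subalgebra_invariants: "subalgebra invariants"
  by (auto simp: subalgebra_def invariant_ring_def act_add act_mult)

lemma order_nonzero: "(of_nat (order G) :: 'k) \<noteq> 0"
  using nonmodular by (simp add: of_nat_eq_0_iff_char_dvd)

definition reynolds :: "('n, 'k) mpoly \<Rightarrow> ('n, 'k) mpoly"
  where "reynolds f = Const (inverse (of_nat (order G))) * (\<Sum>g\<in>carrier G. act G \<phi> g f)"

lemma reynolds_invariant: "reynolds f \<in> invariants"
  unfolding invariant_ring_def
proof (intro CollectI ballI)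
  fix h assume h: "h \<in> carrier G"
  have "(\<Sum>g\<in>carrier G. act G \<phi> (h \<otimes> g) f) = (\<Sum>g\<in>carrier G. act G \<phi> g f)"
    by (rule sum.reindex_bij_witness[of _ "\<lambda>g. inv h \<otimes> g" "\<lambda>g. h \<otimes> g"])
      (use h in \<open>auto simp: m_assoc[symmetric]\<close>)
  moreover have "(\<Sum>g\<in>carrier G. act G \<phi> h (act G \<phi> g f)) = (\<Sum>g\<in>carrier G. act G \<phi> (h \<otimes> g) f)"
    using h by (intro sum.cong) (auto simp: act_act)
  ultimately show "act G \<phi> h (reynolds f) = reynolds f"
    by (simp add: reynolds_def act_mult act_sum)
qed

lemma reynolds_add: "reynolds (f + h) = reynolds f + reynolds h"
  by (simp add: reynolds_def act_add sum.distrib distrib_left)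

lemma reynolds_0: "reynolds 0 = 0"
  by (simp add: reynolds_def)

lemma reynolds_mult:
  assumes "h \<in> invariants"
  shows "reynolds (f * h) = reynolds f * h"
proof -
  have "(\<Sum>g\<in>carrier G. act G \<phi> g (f * h)) = (\<Sum>g\<in>carrier G. act G \<phi> g f) * h"
    using assms by (simp add: act_mult invariant_ring_def sum_distrib_right)
  then show ?thesis by (simp add: reynolds_def mult.assoc)
qed

lemma reynolds_1: "reynolds 1 = 1"
proof -
  have "reynolds 1 = Const (inverse (of_nat (order G)) * of_nat (order G))"
    by (simp add: reynolds_def Coset.order_def Const_mult Const_of_nat)
  also have "\<dots> = 1" using order_nonzero by simp
  finally show ?thesis .
qed

lemma reynolds_id: "f \<in> invariants \<Longrightarrow> reynolds f = f"
  using reynolds_mult[of f 1] by (simp add: reynolds_1)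

lemma homogeneous_reynolds: "homogeneous d f \<Longrightarrow> homogeneous d (reynolds f)"
  unfolding reynolds_def by (intro homogeneous_Const_mult homogeneous_sum homogeneous_act)

section \<open>The Hilbert ideal\<close>

lemma hilbert_ideal_ideal: "ideal (hilbert_ideal G \<phi>)"
  by (simp add: hilbert_ideal_def)

lemma hilbert_ideal_hcomp: "f \<in> hilbert_ideal G \<phi> \<Longrightarrow> hcomp t f \<in> hilbert_ideal G \<phi>"
proof (rule homogeneously_generated_hcomp)
  show "homogeneously_generated UNIV (hilbert_ideal G \<phi>)"
    unfolding homogeneously_generated_def hilbert_ideal_def
    by (intro exI[of _ "{f \<in> invariants. \<exists>d>0. homogeneous d f}"]) auto
qed

lemma hilbert_ideal_invariant:
  "f \<in> invariants \<Longrightarrow> homogeneous d f \<Longrightarrow> d > 0 \<Longrightarrow> f \<in> hilbert_ideal G \<phi>"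
  unfolding hilbert_ideal_def by (rule ideal_generated_superset) blast

text \<open>
  The minimal generators provided by the resolution need not be invariants. But the component of degree
  \<open>t \<le> r\<close> of a combination of homogeneous invariants involves only the invariants of degree at most
  \<open>t\<close>, so these already generate the part of the ideal of degree at most \<open>r\<close>.
\<close>

lemma hilbert_ideal_generated_low_degree:
  assumes "regular_ideal r (hilbert_ideal G \<phi>)"
  shows "hilbert_ideal G \<phi> \<subseteq> ideal_generated {f \<in> invariants. \<exists>d>0. d \<le> r \<and> homogeneous d f}"
    (is "?J \<subseteq> ideal_generated ?S")
proof -
  have low: "hcomp t f \<in> ideal_generated ?S" if "f \<in> ?J" "t \<le> r" for f t
    using that(1) unfolding hilbert_ideal_def
  proof (induction rule: ideal_generated_induct)
    case zero
    show ?case using ideal_0[OF ideal_ideal_generated] by simp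
  next
    case (add a s f')
    then obtain d where s: "s \<in> invariants" "d > 0" "homogeneous d s" by blast
    have "hcomp (t - d) a * s \<in> ideal_generated ?S"
    proof (cases "d \<le> r")
      case True
      with s have "s \<in> ideal_generated ?S" by (intro ideal_generated_superset) blast
      then show ?thesis by (rule ideal_mult[OF ideal_ideal_generated])
    next
      case False
      then have "hcomp (t - d) a = 0" using that(2) by (intro homogeneous_neg[OF homogeneous_hcomp]) simp
      then show ?thesis using ideal_0[OF ideal_ideal_generated] by simp
    qed
    then have "hcomp (t - d) a * s + hcomp t f' \<in> ideal_generated ?S"
      using add(2) by (rule ideal_add[OF ideal_ideal_generated])
    then show ?case using s(3) by (simp add: hcomp_add hcomp_mult)
  qed
  obtain F e A where F: "minimal_free_resolution ?J F e A" "\<forall>i. \<forall>d\<in>set (F i). d \<le> r + int i"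
    using assms unfolding regular_ideal_def by blast
  then have aug: "augmentation (F 0) e ` free_module (F 0) = ?J"
    and hom: "\<And>j. j < length (F 0) \<Longrightarrow> homogeneous (F 0 ! j) (e j)"
    unfolding minimal_free_resolution_def by auto
  have gen: "e j \<in> ideal_generated ?S" if j: "j < length (F 0)" for j
  proof -
    have "e j = augmentation (F 0) e (\<lambda>i. if i = j then 1 else 0)"
      using j by (simp add: augmentation_def if_distrib[of "\<lambda>x. x * _"] cong: if_cong)
    then have "e j \<in> ?J"
      unfolding aug[symmetric] using j by (intro image_eqI) (auto simp: free_module_def)
    moreover have "F 0 ! j \<le> r" using F(2) j by (metis add_0_right nth_mem of_nat_0)
    ultimately have "hcomp (F 0 ! j) (e j) \<in> ideal_generated ?S" by (rule low)
    then show ?thesis using hcomp_homogeneous[OF hom[OF j]] by simp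
  qed
  show ?thesis
  proof
    fix f assume "f \<in> ?J"
    then obtain v where "f = (\<Sum>j<length (F 0). v j * e j)"
      unfolding aug[symmetric] augmentation_def by blast
    also have "\<dots> \<in> ideal_generated ?S"
      by (intro ideal_sum_mem[OF ideal_ideal_generated] ideal_mult[OF ideal_ideal_generated] gen) auto
    finally show "f \<in> ideal_generated ?S" .
  qed
qed

text \<open>
  Hilbert's argument: in a homogeneous invariant of degree \<open>t > r\<close>, written as a combination of
  invariants of degree at most \<open>r\<close>, the Reynolds operator replaces the coefficients by invariants of
  degree less than \<open>t\<close>.
\<close>

lemma beta_le_if_regular:
  assumes reg: "regular_ideal r (hilbert_ideal G \<phi>)" and r: "0 \<le> r"
  shows "int (beta G \<phi>) \<le> r"
proof -
  let ?S = "{f \<in> invariants. degree_le (nat r) f}"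
  let ?A = "algebra_generated ?S"
  have A: "subalgebra ?A"
    unfolding algebra_generated_def by (rule hull_in) (auto simp: subalgebra_def)
  have SA: "?S \<subseteq> ?A"
    unfolding algebra_generated_def by (rule hull_subset)
  have A_0: "0 \<in> ?A"
    using A rangeI[of "Const :: 'k \<Rightarrow> ('n, 'k) mpoly" 0] unfolding subalgebra_def by auto
  have A_add: "f + h \<in> ?A" and A_mult: "f * h \<in> ?A" if "f \<in> ?A" "h \<in> ?A" for f h
    using A that unfolding subalgebra_def by auto
  have A_sum: "(\<Sum>x\<in>X. F x) \<in> ?A" if "\<And>x. x \<in> X \<Longrightarrow> F x \<in> ?A" for F :: "int \<Rightarrow> _" and X
    using that by (induction X rule: infinite_finite_induct) (auto intro: A_0 A_add)
  have hom: "f \<in> ?A" if "f \<in> invariants" "homogeneous t f" for f t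
    using that
  proof (induction "nat t" arbitrary: t f rule: less_induct)
    case less
    show ?case
    proof (cases "t \<le> r")
      case True
      have "degree_le (nat r) f"
        using less.prems(2) True by (auto simp: degree_le_def homogeneous_def)
      with less.prems SA show ?thesis by blast
    next
      case False
      have "reynolds (hcomp t h) \<in> ?A"
        if "h \<in> ideal_generated {f \<in> invariants. \<exists>d>0. d \<le> r \<and> homogeneous d f}" for h
        using that
      proof (induction rule: ideal_generated_induct)
        case zero
        show ?case using A_0 by (simp add: reynolds_0)
      next
        case (add a s h)
        then obtain d where s: "s \<in> invariants" "d > 0" "d \<le> r" "homogeneous d s" by blast
        have "reynolds (hcomp (t - d) a) \<in> ?A"
        proof (rule less.hyps)
          show "nat (t - d) < nat t" using False r s(2) by simp
        qed (simp_all add: reynolds_invariant homogeneous_reynolds)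
        moreover have "degree_le (nat r) s"
          using s(3,4) by (auto simp: degree_le_def homogeneous_def)
        then have "s \<in> ?A" using s(1) SA by blast
        ultimately have "reynolds (hcomp (t - d) a) * s + reynolds (hcomp t h) \<in> ?A"
          using add(2) by (intro A_add A_mult)
        then show ?case using s(4) by (simp add: hcomp_add hcomp_mult reynolds_add reynolds_mult[OF s(1)])
      qed
      moreover have "f \<in> hilbert_ideal G \<phi>"
        using less.prems False r by (intro hilbert_ideal_invariant) auto
      ultimately have "reynolds (hcomp t f) \<in> ?A"
        using hilbert_ideal_generated_low_degree[OF reg] by blast
      then show ?thesis
        using less.prems hcomp_homogeneous[of t f t] by (simp add: reynolds_id)
    qed
  qed
  have "?A = invariants"
  proof
    show "?A \<subseteq> invariants"
      unfolding algebra_generated_def by (intro hull_minimal subalgebra_invariants) auto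
    show "invariants \<subseteq> ?A"
    proof
      fix f assume f: "f \<in> invariants"
      have "(\<Sum>t\<in>(\<lambda>m. int (mdeg m)) ` Poly_Mapping.keys f. hcomp t f) \<in> ?A"
        using f by (intro A_sum hom[OF _ homogeneous_hcomp] invariant_hcomp)
      also have "(\<Sum>t\<in>(\<lambda>m. int (mdeg m)) ` Poly_Mapping.keys f. hcomp t f) = f"
        by (intro sum_hcomp) auto
      finally show "f \<in> ?A" .
    qed
  qed
  then have "beta G \<phi> \<le> nat r" unfolding beta_def by (rule Least_le)
  then show ?thesis using r by simp
qed

end

section \<open>The ideal of the graph\<close>

lemma case_sum_comp: "(\<lambda>x. F (case_sum f g x)) = case_sum (\<lambda>x. F (f x)) (\<lambda>x. F (g x))"
  by (auto simp: fun_eq_iff split: sum.split)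

context nonmodular_representation
begin

text \<open>
  The polynomial \<open>f(x, g x)\<close>, that is, the restriction of \<open>f\<close> to the graph of \<open>g\<close>.
\<close>

definition graph_subst :: "'g \<Rightarrow> ('n + 'n, 'k) mpoly \<Rightarrow> ('n, 'k) mpoly"
  where "graph_subst g = substitute (case_sum Var (\<lambda>i. \<Sum>j\<in>UNIV. Const (matrix (\<phi> g) $ i $ j) * Var j))"

definition graph_form :: "'g \<Rightarrow> 'n \<Rightarrow> ('n + 'n, 'k) mpoly"
  where "graph_form g i = Var (Inr i) - (\<Sum>j\<in>UNIV. Const (matrix (\<phi> g) $ i $ j) * Var (Inl j))"

lemma eval_graph_subst:
  assumes "g \<in> carrier G"
  shows "eval_at (($) v) (graph_subst g f) = eval_at (case_sum (($) v) (($) (\<phi> g v))) f"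
proof -
  have "eval_at (($) v) (\<Sum>j\<in>UNIV. Const (matrix (\<phi> g) $ i $ j) * Var j) = \<phi> g v $ i" for i
    using matrix_\<phi>[OF assms, of i v] by (simp add: id_def eval_at_simps)
  moreover have "eval_at (($) v) (Var i) = v $ i" for i
    by (simp add: id_def eval_at_simps)
  ultimately show ?thesis
    unfolding graph_subst_def eval_at_substitute case_sum_comp by simp
qed

text \<open>
  Modulo the linear forms \<open>graph_form g\<close>, every polynomial \<open>f(x, y)\<close> is congruent to \<open>f(x, g x)\<close>, read as a
  polynomial in the variables \<open>x\<close> alone.
\<close>

lemma graph_subst_eq_0_iff:
  "graph_subst g f = 0 \<longleftrightarrow> f \<in> ideal_generated (range (graph_form g))"
proof
  let ?I = "ideal_generated (range (graph_form g))"
  let ?\<iota> = "substitute (\<lambda>i. Var (Inl i))"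
  have diff: "f - ?\<iota> (graph_subst g f) \<in> ?I" for f
  proof (induction f rule: mpoly_induct)
    case (Const c)
    show ?case
      using ideal_0[OF ideal_ideal_generated] by (simp add: graph_subst_def substitute.evaluate_simps)
  next
    case (Var x)
    show ?case
    proof (cases x)
      case (Inl i)
      then show ?thesis
        using ideal_0[OF ideal_ideal_generated] by (simp add: graph_subst_def substitute.evaluate_simps)
    next
      case (Inr i)
      have "Var x - ?\<iota> (graph_subst g (Var x)) = graph_form g i"
        by (simp add: Inr graph_form_def graph_subst_def substitute.evaluate_simps)
      then show ?thesis by (simp add: ideal_generated_superset)
    qed
  next
    case (add f h)
    from ideal_add[OF ideal_ideal_generated add]
    show ?case by (simp add: graph_subst_def substitute.evaluate_simps algebra_simps)
  next
    case (mult f h)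
    have "h * (f - ?\<iota> (graph_subst g f)) + ?\<iota> (graph_subst g f) * (h - ?\<iota> (graph_subst g h)) \<in> ?I"
      using mult by (intro ideal_add[OF ideal_ideal_generated] ideal_mult[OF ideal_ideal_generated])
    then show ?case by (simp add: graph_subst_def substitute.evaluate_simps algebra_simps)
  qed
  show "f \<in> ?I" if "graph_subst g f = 0"
    using diff[of f] that by (simp add: substitute.evaluate_0)
  show "graph_subst g f = 0" if "f \<in> ?I"
    using that
  proof (induction rule: ideal_generated_induct)
    case zero
    show ?case by (simp add: graph_subst_def substitute.evaluate_0)
  next
    case (add a s h)
    then obtain i where "s = graph_form g i" by blast
    then have "graph_subst g s = 0"
      by (simp add: graph_form_def graph_subst_def substitute.evaluate_simps)
    then show ?case using add(2) by (simp add: graph_subst_def substitute.evaluate_simps)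
  qed
qed

lemma vanishing_ideal_graph:
  "vanishing_ideal (graph_points G \<phi>) = (\<Inter>g\<in>carrier G. ideal_generated (range (graph_form g)))"
proof -
  have "f \<in> vanishing_ideal (graph_points G \<phi>) \<longleftrightarrow>
      (\<forall>g\<in>carrier G. \<forall>v. eval_at (case_sum (($) v) (($) (\<phi> g v))) f = 0)" for f
    unfolding vanishing_ideal_def graph_points_def by blast
  also have "\<dots> f \<longleftrightarrow> (\<forall>g\<in>carrier G. graph_subst g f = 0)" for f
  proof (intro ball_cong refl)
    fix g assume g: "g \<in> carrier G"
    have "(\<forall>v. eval_at (($) v) (graph_subst g f) = 0) \<longleftrightarrow> graph_subst g f = 0"
      using mpoly_eqI[of "graph_subst g f" 0] by (auto simp only: eval_at.evaluate_0)
    then show "(\<forall>v. eval_at (case_sum (($) v) (($) (\<phi> g v))) f = 0) \<longleftrightarrow> graph_subst g f = 0"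
      unfolding eval_graph_subst[OF g] .
  qed
  finally show ?thesis by (auto simp: graph_subst_eq_0_iff)
qed

lemma in_class_graph: "in_class (order G) (vanishing_ideal (graph_points G \<phi>))"
proof -
  have linear: "linear_ideal (ideal_generated (range (graph_form g)))" for g
    unfolding linear_ideal_def graph_form_def
    by (intro exI conjI refl) (auto intro!: homogeneous_diff homogeneous_sum homogeneous_Const_mult)
  have "in_class (card S) (\<Inter>g\<in>S. ideal_generated (range (graph_form g)))" if "finite S" "S \<noteq> {}" for S
    using that
  proof (induction S rule: finite_ne_induct)
    case (singleton g)
    show ?case using linear_1[OF linear[of g]] by (simp add: One_nat_def)
  next
    case (insert g S)
    have "in_class (card (insert g S)) (ideal_sum (ideal_generated (range (graph_form g)) \<inter>
        (\<Inter>g\<in>S. ideal_generated (range (graph_form g)))) {0})"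
      using insert by (intro inter[OF linear_1[OF linear] insert.IH class_0_1[OF zero_0]]) (auto simp: One_nat_def Suc_le_eq card_gt_0_iff)
    then show ?case by simp
  qed
  moreover have "carrier G \<noteq> {}" by blast
  ultimately show ?thesis
    unfolding vanishing_ideal_graph Coset.order_def using finite_carrier by blast
qed

lemma c_number_props:
  shows "c_number G \<phi> \<le> order G" and "c_number G \<phi> > 0"
    and "in_class (c_number G \<phi>) (vanishing_ideal (graph_points G \<phi>))"
proof -
  have *: "order G > 0 \<and> in_class (order G) (vanishing_ideal (graph_points G \<phi>))"
    using in_class_graph finite_carrier by (simp add: order_gt_0_iff_finite)
  then show "c_number G \<phi> \<le> order G" unfolding c_number_def by (rule Least_le)
  from LeastI[of "\<lambda>d. d > 0 \<and> in_class d (vanishing_ideal (graph_points G \<phi>))", OF *]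
  show "c_number G \<phi> > 0" "in_class (c_number G \<phi>) (vanishing_ideal (graph_points G \<phi>))"
    unfolding c_number_def by blast+
qed

definition zero_subst :: "('n + 'n, 'k) mpoly \<Rightarrow> ('n, 'k) mpoly"
  where "zero_subst = substitute (case_sum Var (\<lambda>_. 0))"

lemma reynolds_alt: "reynolds f = Const (inverse (of_nat (order G))) * (\<Sum>g\<in>carrier G. act G \<phi> (inv g) f)"
proof -
  have "(\<Sum>g\<in>carrier G. act G \<phi> (inv g) f) = (\<Sum>g\<in>carrier G. act G \<phi> g f)"
    by (rule sum.reindex_bij_witness[of _ "\<lambda>g. inv g" "\<lambda>g. inv g"]) auto
  then show ?thesis by (simp add: reynolds_def)
qed

text \<open>
  It suffices to consider \<open>f = p(x) q(y)\<close> with a monomial \<open>q\<close>. The average of \<open>p(x) q(g x)\<close> is \<open>p\<close> times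
  the Reynolds operator applied to \<open>q\<close>. If \<open>q\<close> is not constant, this is a multiple of a homogeneous
  invariant of positive degree, while \<open>f(x, 0) = 0\<close>. If \<open>q = 1\<close>, both sides agree.
\<close>

lemma average_graph_subst:
  "Const (inverse (of_nat (order G))) * (\<Sum>g\<in>carrier G. graph_subst g f) - zero_subst f \<in> hilbert_ideal G \<phi>"
proof (induction f rule: poly_mapping_single_induct)
  case zero
  show ?case
    using ideal_0[OF hilbert_ideal_ideal] by (simp add: graph_subst_def zero_subst_def substitute.evaluate_0)
next
  case (add f h)
  from ideal_add[OF hilbert_ideal_ideal add] show ?case
    by (simp add: graph_subst_def zero_subst_def substitute.evaluate_add sum.distrib algebra_simps)
next
  case (single m a)
  define p where "p = Const a * (\<Prod>i\<in>UNIV. Var i ^ Poly_Mapping.lookup m (Inl i) :: ('n, 'k) mpoly)"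
  define q where "q = (\<Prod>i\<in>UNIV. Var i ^ Poly_Mapping.lookup m (Inr i) :: ('n, 'k) mpoly)"
  have split: "(\<Prod>x\<in>UNIV. s x ^ Poly_Mapping.lookup m x) =
      (\<Prod>i\<in>UNIV. s (Inl i) ^ Poly_Mapping.lookup m (Inl i)) * (\<Prod>i\<in>UNIV. s (Inr i) ^ Poly_Mapping.lookup m (Inr i))"
    for s :: "'n + 'n \<Rightarrow> ('n, 'k) mpoly"
    using prod.Plus[of "UNIV :: 'n set" "UNIV :: 'n set" "\<lambda>x. s x ^ Poly_Mapping.lookup m x"]
    by (simp add: UNIV_Plus_UNIV)
  have graph: "graph_subst g (Poly_Mapping.single m a) = p * act G \<phi> (inv g) q" if "g \<in> carrier G" for g
  proof -
    have "act G \<phi> (inv g) (Var i) = (\<Sum>j\<in>UNIV. Const (matrix (\<phi> g) $ i $ j) * Var j)" for i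
      using that by (simp add: act_def substitute.evaluate_Var)
    then show ?thesis
      by (simp add: graph_subst_def substitute.evaluate_single split p_def q_def act_prod act_power mult.assoc)
  qed
  have sum: "Const (inverse (of_nat (order G))) * (\<Sum>g\<in>carrier G. graph_subst g (Poly_Mapping.single m a)) = p * reynolds q"
    by (simp add: graph reynolds_alt sum_distrib_left mult.left_commute)
  have zero: "zero_subst (Poly_Mapping.single m a) = p * (\<Prod>i\<in>UNIV. 0 ^ Poly_Mapping.lookup m (Inr i))"
    by (simp add: zero_subst_def substitute.evaluate_single split p_def mult.assoc)
  show ?case
  proof (cases "\<forall>i. Poly_Mapping.lookup m (Inr i) = 0")
    case True
    then have "q = 1" by (simp add: q_def)
    then show ?thesis
      unfolding sum zero using True ideal_0[OF hilbert_ideal_ideal] by (simp add: reynolds_1)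
  next
    case False
    then obtain i where i: "Poly_Mapping.lookup m (Inr i) > 0" by auto
    define d where "d = (\<Sum>i\<in>UNIV. int (Poly_Mapping.lookup m (Inr i)) * 1)"
    have "homogeneous d q"
      unfolding q_def d_def by (intro homogeneous_prod homogeneous_power homogeneous_Var)
    moreover have "d > 0"
      unfolding d_def using i by (intro sum_pos2[of _ i]) auto
    ultimately have "reynolds q \<in> hilbert_ideal G \<phi>"
      by (intro hilbert_ideal_invariant[OF reynolds_invariant homogeneous_reynolds])
    moreover have "(\<Prod>i\<in>UNIV. 0 ^ Poly_Mapping.lookup m (Inr i) :: ('n, 'k) mpoly) = 0"
      using i by (intro prod_zero) (auto simp: power_0_left)
    ultimately show ?thesis
      unfolding sum zero using ideal_mult[OF hilbert_ideal_ideal] by simp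
  qed
qed

lemma zero_subst_vanishing_ideal:
  assumes "f \<in> vanishing_ideal (graph_points G \<phi>)"
  shows "zero_subst f \<in> hilbert_ideal G \<phi>"
proof -
  have "graph_subst g f = 0" if "g \<in> carrier G" for g
    using assms that by (simp add: vanishing_ideal_graph graph_subst_eq_0_iff)
  then have "0 - zero_subst f \<in> hilbert_ideal G \<phi>"
    using average_graph_subst[of f] by simp
  from ideal_mult[OF hilbert_ideal_ideal this, of "- 1"] show ?thesis by simp
qed

definition y_ideal :: "('n + 'n, 'k) mpoly set"
  where "y_ideal = ideal_generated (range (\<lambda>i. Var (Inr i)))"

lemma linear_y_ideal: "linear_ideal y_ideal"
  unfolding linear_ideal_def y_ideal_def by (intro exI conjI refl) auto

lemma y_ideal_ideal: "ideal y_ideal"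
  by (simp add: y_ideal_def)

lemma zero_subst_y_ideal: "f \<in> y_ideal \<Longrightarrow> zero_subst f = 0"
  unfolding y_ideal_def
  by (induction rule: ideal_generated_induct) (auto simp: zero_subst_def substitute.evaluate_simps)

text \<open>
  As a polynomial in \<open>x\<^sub>i\<close> it is monic of degree \<open>|G|\<close>, its roots are the \<open>i\<close>-th coordinates of the points of the
  orbit of \<open>y\<close>, and the other coefficients vanish at \<open>y = 0\<close>.
\<close>

definition norm_poly :: "'n \<Rightarrow> ('n + 'n, 'k) mpoly"
  where "norm_poly i = (\<Prod>g\<in>carrier G. Var (Inl i) - (\<Sum>j\<in>UNIV. Const (matrix (\<phi> g) $ i $ j) * Var (Inr j)))"

lemma norm_poly_vanishes: "norm_poly i \<in> vanishing_ideal (graph_points G \<phi>)"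
  unfolding vanishing_ideal_def graph_points_def
proof clarify
  fix v h assume h: "h \<in> carrier G"
  have "eval_at (case_sum (($) v) (($) (\<phi> h v))) (norm_poly i) = (\<Prod>g\<in>carrier G. v $ i - \<phi> g (\<phi> h v) $ i)"
    by (simp add: norm_poly_def id_def eval_at_simps matrix_\<phi>)
  also have "\<dots> = 0"
    using h \<phi>_inv[OF h, of v] by (intro prod_zero[OF finite_carrier] bexI[of _ "inv h"]) auto
  finally show "eval_at (case_sum (($) v) (($) (\<phi> h v))) (norm_poly i) = 0" .
qed

lemma power_minus_norm_poly: "Var (Inl i) ^ order G - norm_poly i \<in> y_ideal"
proof -
  define l :: "'g \<Rightarrow> ('n + 'n, 'k) mpoly"
    where "l g = (\<Sum>j\<in>UNIV. Const (matrix (\<phi> g) $ i $ j) * Var (Inr j))" for g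
  have l: "l g \<in> y_ideal" for g
    unfolding l_def by (intro ideal_sum_mem[OF y_ideal_ideal] ideal_mult[OF y_ideal_ideal])
      (simp add: y_ideal_def ideal_generated_superset)
  have "Var (Inl i) ^ card S - (\<Prod>g\<in>S. Var (Inl i) - l g) \<in> y_ideal" if "finite S" for S
    using that
  proof (induction S rule: finite_induct)
    case empty
    show ?case using ideal_0[OF y_ideal_ideal] by simp
  next
    case (insert g S)
    have "Var (Inl i) * (Var (Inl i) ^ card S - (\<Prod>g\<in>S. Var (Inl i) - l g)) + (\<Prod>g\<in>S. Var (Inl i) - l g) * l g \<in> y_ideal"
      by (intro ideal_add[OF y_ideal_ideal] ideal_mult[OF y_ideal_ideal] insert.IH l)
    then show ?case using insert.hyps by (simp add: algebra_simps)
  qed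
  from this[OF finite_carrier] show ?thesis by (simp add: norm_poly_def l_def Coset.order_def)
qed

lemma contains_degree_hilbert_ideal: "contains_degree (c_number G \<phi>) (hilbert_ideal G \<phi>)"
proof -
  let ?b = "vanishing_ideal (graph_points G \<phi>)"
  have ib: "ideal ?b"
    unfolding vanishing_ideal_graph by (intro module.subspace_Inter[OF module_mult]) auto
  have "contains_degree (c_number G \<phi>) (ideal_sum ?b y_ideal)"
  proof (rule in_class_contains_degree[OF c_number_props(3) _ linear_y_ideal])
    show "1 \<le> c_number G \<phi>" using c_number_props(2) by simp
    fix x :: "'n + 'n"
    show "\<exists>N. Var x ^ N \<in> ideal_sum ?b y_ideal"
    proof (cases x)
      case (Inl i)
      have "norm_poly i + (Var (Inl i) ^ order G - norm_poly i) \<in> ideal_sum ?b y_ideal"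
        by (rule ideal_sumI[OF norm_poly_vanishes power_minus_norm_poly])
      then show ?thesis unfolding Inl by (intro exI[of _ "order G"]) simp
    next
      case (Inr i)
      have "Var x ^ 1 \<in> y_ideal" by (simp add: Inr y_ideal_def ideal_generated_superset)
      then show ?thesis using ideal_sumI2[OF ib] by blast
    qed
  qed
  then have c: "f \<in> ideal_sum ?b y_ideal" if "t \<ge> int (c_number G \<phi>)" "homogeneous t f" for t f
    using that unfolding contains_degree_def by blast
  show ?thesis
    unfolding contains_degree_def
  proof (intro allI impI)
    fix t f assume t: "t \<ge> int (c_number G \<phi>)" and f: "homogeneous t (f :: ('n, 'k) mpoly)"
    have "substitute (\<lambda>i. Var (Inl i)) f \<in> ideal_sum ?b y_ideal"
      by (rule c[OF t homogeneous_substitute[OF f homogeneous_Var]])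
    then obtain h y where hy: "substitute (\<lambda>i. Var (Inl i)) f = h + y" "h \<in> ?b" "y \<in> y_ideal"
      unfolding ideal_sum_def by blast
    have "f = zero_subst (substitute (\<lambda>i. Var (Inl i)) f)"
      by (simp add: zero_subst_def substitute_substitute substitute.evaluate_Var substitute_Var)
    also have "\<dots> = zero_subst h + zero_subst y"
      by (simp add: hy(1) zero_subst_def substitute.evaluate_add)
    also have "\<dots> = zero_subst h" by (simp add: zero_subst_y_ideal[OF hy(3)])
    finally show "f \<in> hilbert_ideal G \<phi>"
      using zero_subst_vanishing_ideal[OF hy(2)] by simp
  qed
qed

end

section \<open>The degree bounds\<close>

text \<open>
  Regularity is a least integer, which is meaningful only because the admissible bounds are bounded
  from below.
\<close>

lemma regular_ideal_nonneg:
  assumes "regular_ideal r I" "f \<in> I" "f \<noteq> 0"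
  shows "0 \<le> r"
proof -
  obtain F e A where F: "minimal_free_resolution I F e A" "\<forall>i. \<forall>d\<in>set (F i). d \<le> r + int i"
    using assms(1) unfolding regular_ideal_def by blast
  then have aug: "augmentation (F 0) e ` free_module (F 0) = I"
    and hom: "\<And>j. j < length (F 0) \<Longrightarrow> homogeneous (F 0 ! j) (e j)"
    unfolding minimal_free_resolution_def by auto
  obtain v where "f = (\<Sum>j<length (F 0). v j * e j)"
    using assms(2) unfolding aug[symmetric] augmentation_def by blast
  with assms(3) obtain j where j: "j < length (F 0)" "v j * e j \<noteq> 0"
    by (metis (no_types, lifting) lessThan_iff sum.neutral)
  then have "e j \<noteq> 0" by auto
  then have "0 \<le> F 0 ! j" using homogeneous_neg[OF hom[OF j(1)]] by fastforce
  moreover have "F 0 ! j \<le> r" using F(2) j(1) by (metis add_0_right nth_mem of_nat_0)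
  ultimately show ?thesis by simp
qed

lemma int_Least:
  fixes a :: int
  assumes "P a" and nonneg: "\<And>r. P r \<Longrightarrow> 0 \<le> r"
  shows "P (LEAST r. P r)" and "(LEAST r. P r) \<le> a"
proof -
  define n where "n = (LEAST n. P (int n))"
  have "P (int (nat a))" using assms by simp
  then have Pn: "P (int n)" unfolding n_def by (rule LeastI)
  have le: "int n \<le> r" if "P r" for r
  proof -
    have "P (int (nat r))" using that nonneg by simp
    then have "n \<le> nat r" unfolding n_def by (rule Least_le)
    then show ?thesis using nonneg[OF that] by simp
  qed
  have "(LEAST r. P r) = int n" using Pn le by (rule Least_equality)
  then show "P (LEAST r. P r)" "(LEAST r. P r) \<le> a" using Pn le[OF assms(1)] by simp_all
qed

theorem mainTheorem6:
  fixes G :: "('g, 'b) monoid_scheme"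
    and \<phi> :: "'g \<Rightarrow> 'k::field ^ 'n::finite \<Rightarrow> 'k ^ 'n"
  assumes "infinite (UNIV :: 'k set)"
    and "group G" and "finite (carrier G)"
    and "\<not> CHAR('k) dvd order G"
    and "representation G \<phi>"
  shows "int (beta G \<phi>) \<le> rho G \<phi> \<and> rho G \<phi> \<le> int (c_number G \<phi>) \<and> c_number G \<phi> \<le> order G"
proof -
  interpret nonmodular_representation G \<phi>
    using assms by (simp add: nonmodular_representation_def)
  let ?J = "hilbert_ideal G \<phi>" and ?c = "c_number G \<phi>"
  have regular: "regular_ideal (int ?c) ?J"
    by (rule regular_ideal_if_contains_degree[OF hilbert_ideal_ideal hilbert_ideal_hcomp])
      (use contains_degree_hilbert_ideal in \<open>auto simp: contains_degree_def\<close>)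
  have nonneg: "0 \<le> r" if "regular_ideal r ?J" for r
  proof (rule regular_ideal_nonneg[OF that])
    have "homogeneous (int ?c) (Var undefined ^ ?c :: ('n, 'k) mpoly)"
      using homogeneous_power[OF homogeneous_Var, of ?c undefined] by simp
    then show "Var undefined ^ ?c \<in> ?J"
      using contains_degree_hilbert_ideal unfolding contains_degree_def by blast
    show "Var undefined ^ ?c \<noteq> (0 :: ('n, 'k) mpoly)"
      unfolding power_Var by (metis lookup_single_eq lookup_zero one_neq_zero)
  qed
  have rho: "regular_ideal (rho G \<phi>) ?J" "rho G \<phi> \<le> int ?c"
    unfolding rho_def reg_def by (rule int_Least[of "\<lambda>r. regular_ideal r ?J", OF regular nonneg], assumption)+
  show ?thesis
    using beta_le_if_regular[OF rho(1) nonneg[OF rho(1)]] rho(2) c_number_props(1) by blast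
qed

end
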